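(* Let $(\Lambda,\pi)$ be an action operad. For any $\Lambda$-operad $P$ (in sets), there exists a natural isomorphism of monads on $\mathbf{Sets}$ between $\underline P$ and $\underline{\pi_!P}$. In particular, these monads (and hence the $\Lambda$-operad $P$ and the symmetric operad $\pi_!P$) have isomorphic categories of algebras.
   Context: $\mathbb N\ni 0$; $e_n$ is the identity of $\Lambda(n)$; permutations compose as functions. A (non-symmetric) operad $O$ in sets: sets $O(n)$ ($n\in\mathbb N$), $\mathrm{id}\in O(1)$, functions $\mu:O(n)\times O(k_1)\times\cdots\times O(k_n)\to O(k_1+\cdots+k_n)$, unital and associative in the usual sense; maps preserve $\mathrm{id}$ and $\mu$. The operad $\Sigma$ of symmetric groups has $\mu(\sigma;\tau_1,\dots,\tau_n)=\delta(\sigma)\cdot\beta(\tau_1,\dots,\tau_n)$, with $\beta$ the block sum of the permutations $\tau_i\in\Sigma_{k_i}$ and $\delta(\sigma)=\delta_{n;k_1,\dots,k_n}(\sigma)$ sending $k_1+\cdots+k_{i-1}+a$ ($1\le a\le k_i$) to $(\sum_{\sigma(i')<\sigma(i)}k_{i'})+a$. An action operad $(\Lambda,\pi)$: an operad $\Lambda$ in sets with a group structure on each $\Lambda(n)$ and a map of operads $\pi:\Lambda\to\Sigma$ whose components are group homomorphisms, such that, writing $g(i)=\pi_n(g)(i)$ and $g^{-1}(i)=\pi_n(g)^{-1}(i)$, $\mu(g';f_1',\dots,f_n')\mu(g;f_1,\dots,f_n)=\mu(g'g;f'_{g(1)}f_1,\dots,f'_{g(n)}f_n)$ for $g,g'\in\Lambda(n)$,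 $f_i\in\Lambda(k_i)$, $f_i'\in\Lambda(k_{g^{-1}(i)})$. Put $\beta^\Lambda(g_1,\dots,g_n)=\mu(e_n;g_1,\dots,g_n)$ and $\delta^\Lambda_{n;k_1,\dots,k_n}(g)=\mu(g;e_{k_1},\dots,e_{k_n})$. A $\Lambda$-operad $P$: a non-symmetric operad $P$ with a right action of $\Lambda(n)$ on $P(n)$ for each $n$ such that $\mu(p;q_1\cdot g_1,\dots,q_n\cdot g_n)=\mu(p;q_1,\dots,q_n)\cdot\beta^\Lambda(g_1,\dots,g_n)$ and $\mu(p\cdot g;q_1,\dots,q_n)=\mu(p;q_{g^{-1}(1)},\dots,q_{g^{-1}(n)})\cdot\delta^\Lambda_{n;k_1,\dots,k_n}(g)$ for $p\in P(n)$, $q_i\in P(k_i)$, $g_i\in\Lambda(k_i)$, $g\in\Lambda(n)$. A symmetric operad is a $\Sigma$-operad ($\Sigma$ with $\pi=\mathrm{id}$). $\pi_!P$ is the symmetric operad with $(\pi_!P)(n)=P(n)\otimes_{\Lambda(n)}\Sigma_n$ (quotient of $P(n)\times\Sigma_n$ by $[p\cdot g,\tau]=[p,\pi(g)\tau]$), right $\Sigma_n$-action by multiplication on the second factor, unit $[\mathrm{id},e_1]$ and multiplication $([p,\tau];[p_1,\tau_1],\dots,[p_n,\tau_n])\mapsto[\mu(p;p_{\tau^{-1}(1)},\dots,p_{\tau^{-1}(n)}),\mu^\Sigma(\tau;\tau_1,\dots,\tau_n)]$. $\Lambda(n)$ acts on the left of $X^n$ by $g\cdot(x_1,\dots,x_n)=(x_{g^{-1}(1)},\dots,x_{g^{-1}(n)})$;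 $P(n)\otimes_{\Lambda(n)}X^n$ is the quotient of $P(n)\times X^n$ by $(p\cdot g,\underline x)\sim(p,g\cdot\underline x)$. The monad $\underline P$ is $\underline P(X)=\coprod_nP(n)\otimes_{\Lambda(n)}X^n$, with unit $x\mapsto[\mathrm{id};x]$ and multiplication $[p;[q_1;\underline{x_1}],\dots,[q_n;\underline{x_n}]]\mapsto[\mu(p;q_1,\dots,q_n);\underline{x_1},\dots,\underline{x_n}]$. Algebras for the operad $P$ are (isomorphic to) algebras for the monad $\underline P$. *)

theory Defs
  imports
    "HOL-Algebra.Group"
    "HOL-Algebra.Free_Abelian_Groups"
    "HOL-Combinatorics.Permutations"
    "HOL-Library.FuncSet"
begin

section \<open>Categories, monads and their algebras\<close>

record ('o, 'm) cat =
  Ob :: "'o set"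
  Hom :: "'o \<Rightarrow> 'o \<Rightarrow> 'm set"
  Idn :: "'o \<Rightarrow> 'm"
  Cmp :: "'o \<Rightarrow> 'o \<Rightarrow> 'o \<Rightarrow> 'm \<Rightarrow> 'm \<Rightarrow> 'm"

text \<open>Hom-sets need not be disjoint, so \<open>Cmp C X Y Z g f\<close> (for \<open>f : X \<rightarrow> Y\<close>, \<open>g : Y \<rightarrow> Z\<close>)
  is told the objects; likewise for the action of functors on morphisms.\<close>

locale cat =
  fixes C :: "('o, 'm) cat"
  assumes Idn_Hom: "X \<in> Ob C \<Longrightarrow> Idn C X \<in> Hom C X X"
    and Cmp_Hom: "\<lbrakk>X \<in> Ob C; Y \<in> Ob C; Z \<in> Ob C; f \<in> Hom C X Y; g \<in> Hom C Y Z\<rbrakk>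
      \<Longrightarrow> Cmp C X Y Z g f \<in> Hom C X Z"
    and Cmp_Idn_right: "\<lbrakk>X \<in> Ob C; Y \<in> Ob C; f \<in> Hom C X Y\<rbrakk> \<Longrightarrow> Cmp C X X Y f (Idn C X) = f"
    and Cmp_Idn_left: "\<lbrakk>X \<in> Ob C; Y \<in> Ob C; f \<in> Hom C X Y\<rbrakk> \<Longrightarrow> Cmp C X Y Y (Idn C Y) f = f"
    and Cmp_assoc: "\<lbrakk>W \<in> Ob C; X \<in> Ob C; Y \<in> Ob C; Z \<in> Ob C;
        f \<in> Hom C W X; g \<in> Hom C X Y; h \<in> Hom C Y Z\<rbrakk>
      \<Longrightarrow> Cmp C W Y Z h (Cmp C W X Y g f) = Cmp C W X Z (Cmp C X Y Z h g) f"

record ('o1, 'm1, 'o2, 'm2) fctr =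
  FOb :: "'o1 \<Rightarrow> 'o2"
  FHom :: "'o1 \<Rightarrow> 'o1 \<Rightarrow> 'm1 \<Rightarrow> 'm2"

locale fctr = dom: cat C + cod: cat D
  for C :: "('o1, 'm1) cat" and D :: "('o2, 'm2) cat" +
  fixes F :: "('o1, 'm1, 'o2, 'm2) fctr"
  assumes FOb_Ob: "X \<in> Ob C \<Longrightarrow> FOb F X \<in> Ob D"
    and FHom_Hom: "\<lbrakk>X \<in> Ob C; Y \<in> Ob C; f \<in> Hom C X Y\<rbrakk>
      \<Longrightarrow> FHom F X Y f \<in> Hom D (FOb F X) (FOb F Y)"
    and FHom_Idn: "X \<in> Ob C \<Longrightarrow> FHom F X X (Idn C X) = Idn D (FOb F X)"
    and FHom_Cmp: "\<lbrakk>X \<in> Ob C; Y \<in> Ob C; Z \<in> Ob C; f \<in> Hom C X Y; g \<in> Hom C Y Z\<rbrakk>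
      \<Longrightarrow> FHom F X Z (Cmp C X Y Z g f) =
          Cmp D (FOb F X) (FOb F Y) (FOb F Z) (FHom F Y Z g) (FHom F X Y f)"

definition id_fctr :: "('o, 'm, 'o, 'm) fctr" where
  "id_fctr = \<lparr>FOb = (\<lambda>X. X), FHom = (\<lambda>X Y f. f)\<rparr>"

definition comp_fctr ::
  "('o2, 'm2, 'o3, 'm3) fctr \<Rightarrow> ('o1, 'm1, 'o2, 'm2) fctr \<Rightarrow> ('o1, 'm1, 'o3, 'm3) fctr" where
  "comp_fctr G F = \<lparr>FOb = (\<lambda>X. FOb G (FOb F X)),
     FHom = (\<lambda>X Y f. FHom G (FOb F X) (FOb F Y) (FHom F X Y f))\<rparr>"

definition isomorphic_cats :: "('o1, 'm1) cat \<Rightarrow> ('o2, 'm2) cat \<Rightarrow> bool" where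
  "isomorphic_cats C D \<longleftrightarrow> (\<exists>F G. fctr C D F \<and> fctr D C G \<and>
     (\<forall>X\<in>Ob C. FOb (comp_fctr G F) X = X) \<and>
     (\<forall>X\<in>Ob C. \<forall>Y\<in>Ob C. \<forall>f\<in>Hom C X Y. FHom (comp_fctr G F) X Y f = f) \<and>
     (\<forall>X\<in>Ob D. FOb (comp_fctr F G) X = X) \<and>
     (\<forall>X\<in>Ob D. \<forall>Y\<in>Ob D. \<forall>f\<in>Hom D X Y. FHom (comp_fctr F G) X Y f = f))"

locale nat_trans = src: fctr C D F + tgt: fctr C D G
  for C :: "('o1, 'm1) cat" and D :: "('o2, 'm2) cat" and F G +
  fixes \<eta> :: "'o1 \<Rightarrow> 'm2"
  assumes component: "X \<in> Ob C \<Longrightarrow> \<eta> X \<in> Hom D (FOb F X) (FOb G X)"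
    and naturality: "\<lbrakk>X \<in> Ob C; Y \<in> Ob C; f \<in> Hom C X Y\<rbrakk> \<Longrightarrow>
      Cmp D (FOb F X) (FOb F Y) (FOb G Y) (\<eta> Y) (FHom F X Y f) =
      Cmp D (FOb F X) (FOb G X) (FOb G Y) (FHom G X Y f) (\<eta> X)"

definition iso_in :: "('o, 'm) cat \<Rightarrow> 'o \<Rightarrow> 'o \<Rightarrow> 'm \<Rightarrow> bool" where
  "iso_in C X Y f \<longleftrightarrow> f \<in> Hom C X Y \<and>
     (\<exists>g\<in>Hom C Y X. Cmp C X Y X g f = Idn C X \<and> Cmp C Y X Y f g = Idn C Y)"

record ('o, 'm) mnd =
  Fn :: "('o, 'm, 'o, 'm) fctr"
  Eta :: "'o \<Rightarrow> 'm"
  Mu :: "'o \<Rightarrow> 'm"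

abbreviation TOb :: "('o, 'm) mnd \<Rightarrow> 'o \<Rightarrow> 'o" where
  "TOb T \<equiv> FOb (Fn T)"

abbreviation THom :: "('o, 'm) mnd \<Rightarrow> 'o \<Rightarrow> 'o \<Rightarrow> 'm \<Rightarrow> 'm" where
  "THom T \<equiv> FHom (Fn T)"

locale mnd = cat C + unit: nat_trans C C id_fctr "Fn T" "Eta T" +
    mult: nat_trans C C "comp_fctr (Fn T) (Fn T)" "Fn T" "Mu T"
  for C :: "('o, 'm) cat" and T :: "('o, 'm) mnd" +
  assumes Mu_Eta_left: "X \<in> Ob C \<Longrightarrow>
      Cmp C (TOb T X) (TOb T (TOb T X)) (TOb T X) (Mu T X) (Eta T (TOb T X)) = Idn C (TOb T X)"
    and Mu_Eta_right: "X \<in> Ob C \<Longrightarrow>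
      Cmp C (TOb T X) (TOb T (TOb T X)) (TOb T X) (Mu T X) (THom T X (TOb T X) (Eta T X))
        = Idn C (TOb T X)"
    and Mu_assoc: "X \<in> Ob C \<Longrightarrow>
      Cmp C (TOb T (TOb T (TOb T X))) (TOb T (TOb T X)) (TOb T X)
          (Mu T X) (Mu T (TOb T X)) =
      Cmp C (TOb T (TOb T (TOb T X))) (TOb T (TOb T X)) (TOb T X)
          (Mu T X) (THom T (TOb T (TOb T X)) (TOb T X) (Mu T X))"

text \<open>The horizontal composite of \<open>\<phi>\<close> with itself is \<open>\<phi>\<^bsub>T' X\<^esub> \<circ> T (\<phi>\<^bsub>X\<^esub>)\<close>.\<close>

locale mnd_iso = mnd1: mnd C T + mnd2: mnd C T' + nat_trans C C "Fn T" "Fn T'" \<phi>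
  for C :: "('o, 'm) cat" and T T' :: "('o, 'm) mnd" and \<phi> :: "'o \<Rightarrow> 'm" +
  assumes component_iso: "X \<in> Ob C \<Longrightarrow> iso_in C (TOb T X) (TOb T' X) (\<phi> X)"
    and compat_Eta: "X \<in> Ob C \<Longrightarrow> Cmp C X (TOb T X) (TOb T' X) (\<phi> X) (Eta T X) = Eta T' X"
    and compat_Mu: "X \<in> Ob C \<Longrightarrow>
      Cmp C (TOb T (TOb T X)) (TOb T X) (TOb T' X) (\<phi> X) (Mu T X) =
      Cmp C (TOb T (TOb T X)) (TOb T' (TOb T' X)) (TOb T' X) (Mu T' X)
        (Cmp C (TOb T (TOb T X)) (TOb T (TOb T' X)) (TOb T' (TOb T' X))
           (\<phi> (TOb T' X)) (THom T (TOb T X) (TOb T' X) (\<phi> X)))"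

definition mnd_alg :: "('o, 'm) cat \<Rightarrow> ('o, 'm) mnd \<Rightarrow> ('o \<times> 'm, 'm) cat" where
  "mnd_alg C T = \<lparr>
     Ob = {(A, a). A \<in> Ob C \<and> a \<in> Hom C (TOb T A) A \<and>
        Cmp C A (TOb T A) A a (Eta T A) = Idn C A \<and>
        Cmp C (TOb T (TOb T A)) (TOb T A) A a (Mu T A) =
          Cmp C (TOb T (TOb T A)) (TOb T A) A a (THom T (TOb T A) A a)},
     Hom = (\<lambda>(A, a) (B, b). {f \<in> Hom C A B.
        Cmp C (TOb T A) A B f a = Cmp C (TOb T A) (TOb T B) B b (THom T A B f)}),
     Idn = (\<lambda>(A, a). Idn C A),
     Cmp = (\<lambda>(A, a) (B, b) (D, d). Cmp C A B D)\<rparr>"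

text \<open>The category of sets whose elements are drawn from the type \<open>'u\<close>, which plays the
  role of the universe of small elements.\<close>

definition Sets :: "('u set, 'u \<Rightarrow> 'u) cat" where
  "Sets = \<lparr>Ob = UNIV, Hom = (\<lambda>X Y. X \<rightarrow>\<^sub>E Y), Idn = (\<lambda>X. \<lambda>x\<in>X. x),
     Cmp = (\<lambda>X Y Z g f. compose X g f)\<rparr>"


section \<open>Operads\<close>

text \<open>\<open>mu O ks p qs\<close> is \<open>\<mu>(p; q\<^sub>1, \<dots>, q\<^sub>n)\<close> for \<open>p \<in> O(n)\<close>, \<open>q\<^sub>i \<in> O(k\<^sub>i)\<close>, \<open>n = length ks\<close>;
  the arities are arguments since the sets \<open>O(n)\<close> need not be disjoint.\<close>

record 'a operad_data =
  Op :: "nat \<Rightarrow> 'a set"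
  ident :: 'a
  mu :: "nat list \<Rightarrow> 'a \<Rightarrow> 'a list \<Rightarrow> 'a"

abbreviation in_Ops :: "('a, 'z) operad_data_scheme \<Rightarrow> nat list \<Rightarrow> 'a list \<Rightarrow> bool" where
  "in_Ops Q ks qs \<equiv> list_all2 (\<lambda>q k. q \<in> Op Q k) qs ks"

locale operad =
  fixes Q :: "('a, 'z) operad_data_scheme"
  assumes ident_Op: "ident Q \<in> Op Q 1"
    and mu_Op: "\<lbrakk>p \<in> Op Q (length ks); in_Ops Q ks qs\<rbrakk> \<Longrightarrow> mu Q ks p qs \<in> Op Q (sum_list ks)"
    and mu_ident_left: "p \<in> Op Q n \<Longrightarrow> mu Q [n] (ident Q) [p] = p"
    and mu_ident_right: "p \<in> Op Q n \<Longrightarrow> mu Q (replicate n 1) p (replicate n (ident Q)) = p"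
    and mu_assoc: "\<lbrakk>p \<in> Op Q (length lss); in_Ops Q (map length lss) qs;
        list_all2 (\<lambda>rs ls. in_Ops Q ls rs) rss lss\<rbrakk> \<Longrightarrow>
      mu Q (concat lss) (mu Q (map length lss) p qs) (concat rss) =
      mu Q (map sum_list lss) p (map (\<lambda>(ls, q, rs). mu Q ls q rs) (zip lss (zip qs rss)))"

text \<open>Positions are counted from \<open>0\<close>, so \<open>\<Sigma>\<^sub>n\<close> is the group of permutations of \<open>{..<n}\<close>.
  The left action on tuples is \<open>(\<sigma> \<cdot> x)\<^sub>i = x\<^bsub>\<sigma>\<^sup>-\<^sup>1(i)\<^esub>\<close>.\<close>

definition lact :: "(nat \<Rightarrow> nat) \<Rightarrow> 'x list \<Rightarrow> 'x list" where
  "lact \<sigma> xs = permute_list (Hilbert_Choice.inv \<sigma>) xs"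

text \<open>For \<open>m < \<Sum> ks\<close> write \<open>m = k\<^sub>0 + \<dots> + k\<^bsub>i-1\<^esub> + a\<close> with \<open>a < k\<^sub>i\<close>;
  then \<open>blk ks m = i\<close> and \<open>off ks m = a\<close>.\<close>

definition blk :: "nat list \<Rightarrow> nat \<Rightarrow> nat" where
  "blk ks m = (LEAST i. m < sum_list (take (Suc i) ks))"

definition off :: "nat list \<Rightarrow> nat \<Rightarrow> nat" where
  "off ks m = m - sum_list (take (blk ks m) ks)"

definition block_sum :: "nat list \<Rightarrow> (nat \<Rightarrow> nat) list \<Rightarrow> nat \<Rightarrow> nat" where
  "block_sum ks \<tau>s m = (if m < sum_list ks
     then sum_list (take (blk ks m) ks) + (\<tau>s ! blk ks m) (off ks m) else m)"

definition block_perm :: "nat list \<Rightarrow> (nat \<Rightarrow> nat) \<Rightarrow> nat \<Rightarrow> nat" where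
  "block_perm ks \<sigma> m = (if m < sum_list ks
     then (\<Sum>i\<in>{i. i < length ks \<and> \<sigma> i < \<sigma> (blk ks m)}. ks ! i) + off ks m else m)"

record 'l action_operad_data = "'l operad_data" +
  Gr :: "nat \<Rightarrow> 'l monoid"
  proj :: "nat \<Rightarrow> 'l \<Rightarrow> nat \<Rightarrow> nat"

definition Symm :: "(nat \<Rightarrow> nat) action_operad_data" where
  "Symm = \<lparr>Op = (\<lambda>n. {\<sigma>. \<sigma> permutes {..<n}}), ident = id,
     mu = (\<lambda>ks \<sigma> \<tau>s. block_perm ks \<sigma> \<circ> block_sum ks \<tau>s),
     Gr = (\<lambda>n. \<lparr>carrier = {\<sigma>. \<sigma> permutes {..<n}}, monoid.mult = (\<circ>), one = id\<rparr>),
     proj = (\<lambda>n \<sigma>. \<sigma>)\<rparr>"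

text \<open>In \<open>interchange\<close>, \<open>f'\<^sub>i \<in> \<Lambda>(k\<^bsub>g\<^sup>-\<^sup>1(i)\<^esub>)\<close>, and the \<open>i\<close>-th entry on the
  right-hand side is \<open>f'\<^bsub>g(i)\<^esub> f\<^sub>i\<close>.\<close>

locale action_operad = operad L for L :: "'l action_operad_data" +
  assumes Gr_carrier: "carrier (Gr L n) = Op L n"
    and Gr_group: "group (Gr L n)"
    and proj_hom: "proj L n \<in> hom (Gr L n) (Gr Symm n)"
    and proj_ident: "proj L 1 (ident L) = ident Symm"
    and proj_mu: "\<lbrakk>g \<in> Op L (length ks); in_Ops L ks fs\<rbrakk> \<Longrightarrow>
      proj L (sum_list ks) (mu L ks g fs) =
      mu Symm ks (proj L (length ks) g) (map2 (proj L) ks fs)"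
    and interchange: "\<lbrakk>n = length ks; g \<in> Op L n; g' \<in> Op L n; in_Ops L ks fs;
        in_Ops L (lact (proj L n g) ks) fs'\<rbrakk> \<Longrightarrow>
      mu L (lact (proj L n g) ks) g' fs' \<otimes>\<^bsub>Gr L (sum_list ks)\<^esub> mu L ks g fs =
      mu L ks (g' \<otimes>\<^bsub>Gr L n\<^esub> g)
        (map (\<lambda>i. (fs' ! (proj L n g i)) \<otimes>\<^bsub>Gr L (ks ! i)\<^esub> (fs ! i)) [0..<n])"

definition beta_op :: "'l action_operad_data \<Rightarrow> nat list \<Rightarrow> 'l list \<Rightarrow> 'l" where
  "beta_op L ks gs = mu L ks \<one>\<^bsub>Gr L (length ks)\<^esub> gs"

definition delta_op :: "'l action_operad_data \<Rightarrow> nat list \<Rightarrow> 'l \<Rightarrow> 'l" where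
  "delta_op L ks g = mu L ks g (map (\<lambda>k. \<one>\<^bsub>Gr L k\<^esub>) ks)"

text \<open>\<open>act P n p g\<close> is \<open>p \<cdot> g\<close> for \<open>p \<in> P(n)\<close>, \<open>g \<in> \<Lambda>(n)\<close>.\<close>

record ('p, 'l) lambda_operad_data = "'p operad_data" +
  act :: "nat \<Rightarrow> 'p \<Rightarrow> 'l \<Rightarrow> 'p"

locale lambda_operad = action_operad L + operad P
  for L :: "'l action_operad_data" and P :: "('p, 'l) lambda_operad_data" +
  assumes act_Op: "\<lbrakk>p \<in> Op P n; g \<in> Op L n\<rbrakk> \<Longrightarrow> act P n p g \<in> Op P n"
    and act_one: "p \<in> Op P n \<Longrightarrow> act P n p \<one>\<^bsub>Gr L n\<^esub> = p"
    and act_mult: "\<lbrakk>p \<in> Op P n; g \<in> Op L n; h \<in> Op L n\<rbrakk> \<Longrightarrow>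
      act P n p (g \<otimes>\<^bsub>Gr L n\<^esub> h) = act P n (act P n p g) h"
    and mu_act_inner: "\<lbrakk>p \<in> Op P (length ks); in_Ops P ks qs; in_Ops L ks gs\<rbrakk> \<Longrightarrow>
      mu P ks p (map (\<lambda>(k, q, g). act P k q g) (zip ks (zip qs gs))) =
      act P (sum_list ks) (mu P ks p qs) (beta_op L ks gs)"
    and mu_act_outer: "\<lbrakk>n = length ks; p \<in> Op P n; in_Ops P ks qs; g \<in> Op L n\<rbrakk> \<Longrightarrow>
      mu P ks (act P n p g) qs =
      act P (sum_list ks) (mu P (lact (proj L n g) ks) p (lact (proj L n g) qs))
        (delta_op L ks g)"


section \<open>The induced symmetric operad\<close>

definition rep :: "'a set \<Rightarrow> 'a" where
  "rep S = (SOME x. x \<in> S)"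

text \<open>For a \<open>\<Lambda>\<close>-operad this relation is already an equivalence relation on
  \<open>P(n) \<times> \<Sigma>\<^sub>n\<close>, because \<open>\<Lambda>(n)\<close> is a group; similarly for \<open>und_rel\<close> below.\<close>

definition ind_rel :: "'l action_operad_data \<Rightarrow> ('p, 'l) lambda_operad_data \<Rightarrow> nat
    \<Rightarrow> (('p \<times> (nat \<Rightarrow> nat)) \<times> ('p \<times> (nat \<Rightarrow> nat))) set" where
  "ind_rel L P n = {((act P n p g, \<tau>), (p, proj L n g \<circ> \<tau>)) | p g \<tau>.
     p \<in> Op P n \<and> g \<in> Op L n \<and> \<tau> \<in> Op Symm n}"

definition ind_cls :: "'l action_operad_data \<Rightarrow> ('p, 'l) lambda_operad_data \<Rightarrow> nat
    \<Rightarrow> 'p \<times> (nat \<Rightarrow> nat) \<Rightarrow> ('p \<times> (nat \<Rightarrow> nat)) set" where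
  "ind_cls L P n z = ind_rel L P n `` {z}"

definition induced :: "'l action_operad_data \<Rightarrow> ('p, 'l) lambda_operad_data
    \<Rightarrow> (('p \<times> (nat \<Rightarrow> nat)) set, nat \<Rightarrow> nat) lambda_operad_data" where
  "induced L P = \<lparr>
     Op = (\<lambda>n. (Op P n \<times> Op Symm n) // ind_rel L P n),
     ident = ind_cls L P 1 (ident P, \<one>\<^bsub>Gr Symm 1\<^esub>),
     mu = (\<lambda>ks c cs. case rep c of (p, \<tau>) \<Rightarrow>
       ind_cls L P (sum_list ks)
         (mu P (lact \<tau> ks) p (lact \<tau> (map (fst \<circ> rep) cs)),
          mu Symm ks \<tau> (map (snd \<circ> rep) cs))),
     act = (\<lambda>n c \<sigma>. case rep c of (p, \<tau>) \<Rightarrow> ind_cls L P n (p, \<tau> \<otimes>\<^bsub>Gr Symm n\<^esub> \<sigma>))\<rparr>"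


section \<open>The monad and the algebras of a \<open>\<Lambda>\<close>-operad\<close>

text \<open>The coproduct over \<open>n\<close> of the \<open>P(n) \<otimes> X\<^sup>n\<close> is formed as one quotient of a set of
  pairs \<open>(p, xs)\<close>, the length of \<open>xs\<close> recording the summand. The class of \<open>(p, xs)\<close> only
  involves permutations of \<open>xs\<close>, hence does not depend on the set \<open>X\<close>.\<close>

definition und_rel :: "'l action_operad_data \<Rightarrow> ('p, 'l) lambda_operad_data
    \<Rightarrow> (('p \<times> 'x list) \<times> ('p \<times> 'x list)) set" where
  "und_rel L P = {((act P n p g, xs), (p, lact (proj L n g) xs)) | n p g xs.
     p \<in> Op P n \<and> g \<in> Op L n \<and> length xs = n}"

definition und_cls :: "'l action_operad_data \<Rightarrow> ('p, 'l) lambda_operad_data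
    \<Rightarrow> 'p \<times> 'x list \<Rightarrow> ('p \<times> 'x list) set" where
  "und_cls L P z = und_rel L P `` {z}"

definition und_obj :: "'l action_operad_data \<Rightarrow> ('p, 'l) lambda_operad_data
    \<Rightarrow> 'x set \<Rightarrow> ('p \<times> 'x list) set set" where
  "und_obj L P X = {(p, xs). xs \<in> lists X \<and> p \<in> Op P (length xs)} // und_rel L P"

definition und_map :: "'l action_operad_data \<Rightarrow> ('p, 'l) lambda_operad_data
    \<Rightarrow> ('x \<Rightarrow> 'y) \<Rightarrow> ('p \<times> 'x list) set \<Rightarrow> ('p \<times> 'y list) set" where
  "und_map L P f t = (case rep t of (p, xs) \<Rightarrow> und_cls L P (p, map f xs))"

definition und_unit :: "'l action_operad_data \<Rightarrow> ('p, 'l) lambda_operad_data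
    \<Rightarrow> 'x \<Rightarrow> ('p \<times> 'x list) set" where
  "und_unit L P x = und_cls L P (ident P, [x])"

definition und_mult :: "'l action_operad_data \<Rightarrow> ('p, 'l) lambda_operad_data
    \<Rightarrow> ('p \<times> ('p \<times> 'x list) set list) set \<Rightarrow> ('p \<times> 'x list) set" where
  "und_mult L P t = (case rep t of (p, ts) \<Rightarrow>
     und_cls L P
       (mu P (map (length \<circ> snd \<circ> rep) ts) p (map (fst \<circ> rep) ts), concat (map (snd \<circ> rep) ts)))"

text \<open>The elements of \<open>und_obj L P X\<close> do not have the type of the elements of \<open>X\<close>. To obtain
  an endofunctor of \<^const>\<open>Sets\<close>, they are named by elements of the universe by means of a
  map \<open>c\<close> that is injective on \<open>und_obj L P UNIV\<close>; everything is transported along \<open>c\<close>.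
  Such \<open>c\<close> exist whenever the universe is infinite and not smaller than \<open>P\<close>
  (see \<open>und_coding_exists\<close> and \<open>induced_coding_exists\<close>), and different choices
  give isomorphic monads.\<close>

definition und_dec :: "(('p \<times> 'u list) set \<Rightarrow> 'u) \<Rightarrow> 'l action_operad_data
    \<Rightarrow> ('p, 'l) lambda_operad_data \<Rightarrow> 'u \<Rightarrow> ('p \<times> 'u list) set" where
  "und_dec c L P = the_inv_into (und_obj L P UNIV) c"

definition und_mnd :: "(('p \<times> 'u list) set \<Rightarrow> 'u) \<Rightarrow> 'l action_operad_data
    \<Rightarrow> ('p, 'l) lambda_operad_data \<Rightarrow> ('u set, 'u \<Rightarrow> 'u) mnd" where
  "und_mnd c L P = \<lparr>
     Fn = \<lparr>FOb = (\<lambda>X. c ` und_obj L P X),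
            FHom = (\<lambda>X Y f. \<lambda>t\<in>c ` und_obj L P X. c (und_map L P f (und_dec c L P t)))\<rparr>,
     Eta = (\<lambda>X. \<lambda>x\<in>X. c (und_unit L P x)),
     Mu = (\<lambda>X. \<lambda>t\<in>c ` und_obj L P (c ` und_obj L P X).
        c (und_mult L P (und_map L P (und_dec c L P) (und_dec c L P t))))\<rparr>"

text \<open>An algebra structure on \<open>A\<close> consists of maps \<open>P(n) \<times> A\<^sup>n \<rightarrow> A\<close> for all \<open>n\<close>,
  gathered into one map.\<close>

definition is_operad_alg :: "'l action_operad_data \<Rightarrow> ('p, 'l) lambda_operad_data
    \<Rightarrow> 'u set \<Rightarrow> ('p \<times> 'u list \<Rightarrow> 'u) \<Rightarrow> bool" where
  "is_operad_alg L P A \<theta> \<longleftrightarrow>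
     \<theta> \<in> {(p, xs). xs \<in> lists A \<and> p \<in> Op P (length xs)} \<rightarrow>\<^sub>E A \<and>
     (\<forall>x\<in>A. \<theta> (ident P, [x]) = x) \<and>
     (\<forall>p qs xss. xss \<in> lists (lists A) \<and> p \<in> Op P (length xss) \<and> in_Ops P (map length xss) qs
        \<longrightarrow> \<theta> (mu P (map length xss) p qs, concat xss) = \<theta> (p, map \<theta> (zip qs xss))) \<and>
     (\<forall>n p g xs. xs \<in> lists A \<and> length xs = n \<and> p \<in> Op P n \<and> g \<in> Op L n
        \<longrightarrow> \<theta> (act P n p g, xs) = \<theta> (p, lact (proj L n g) xs))"

definition operad_alg :: "'l action_operad_data \<Rightarrow> ('p, 'l) lambda_operad_data
    \<Rightarrow> ('u set \<times> ('p \<times> 'u list \<Rightarrow> 'u), 'u \<Rightarrow> 'u) cat" where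
  "operad_alg L P = \<lparr>
     Ob = {(A, \<theta>). is_operad_alg L P A \<theta>},
     Hom = (\<lambda>(A, \<theta>) (B, \<theta>'). {f \<in> Hom Sets A B.
        \<forall>p xs. xs \<in> lists A \<and> p \<in> Op P (length xs) \<longrightarrow> f (\<theta> (p, xs)) = \<theta>' (p, map f xs)}),
     Idn = (\<lambda>(A, \<theta>). Idn Sets A),
     Cmp = (\<lambda>(A, \<theta>) (B, \<theta>') (D, \<theta>''). Cmp Sets A B D)\<rparr>"


section \<open>Existence of codings\<close>

lemma ex_inj_list:
  assumes "infinite (UNIV :: 'u set)"
  shows "\<exists>f :: 'u list \<Rightarrow> 'u. inj f"
proof -
  have "|lists (UNIV :: 'u set)| =o |UNIV :: 'u set|"
    using assms by (rule card_of_lists_infinite)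
  then obtain f :: "'u list \<Rightarrow> 'u" where "bij_betw f (lists UNIV) UNIV"
    using card_of_ordIso by blast
  then show ?thesis
    by (auto simp: bij_betw_def lists_UNIV)
qed

lemma ex_inj_on_quotient:
  fixes f :: "'a \<Rightarrow> 'b"
  assumes "inj_on f A"
  shows "\<exists>c :: 'a set \<Rightarrow> 'b. inj_on c (A // r)"
proof -
  have "\<forall>C\<in>A // r. \<exists>z\<in>A. C = r `` {z}"
    by (auto elim: quotientE)
  then obtain s where s: "\<And>C. C \<in> A // r \<Longrightarrow> s C \<in> A \<and> C = r `` {s C}"
    by metis
  have "inj_on (f \<circ> s) (A // r)"
    by (rule inj_onI) (metis s assms comp_apply inj_onD)
  then show ?thesis
    by blast
qed

lemma und_coding_exists:
  fixes P :: "('p, 'l) lambda_operad_data" and i :: "'p \<Rightarrow> 'u"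
  assumes "infinite (UNIV :: 'u set)" and "inj_on i (\<Union>n. Op P n)"
  shows "\<exists>c :: ('p \<times> 'u list) set \<Rightarrow> 'u. inj_on c (und_obj L P UNIV)"
proof -
  obtain f :: "'u list \<Rightarrow> 'u" where "inj f"
    using ex_inj_list[OF assms(1)] by blast
  then have "inj_on (\<lambda>(p, xs). f (i p # xs)) {(p, xs). xs \<in> lists UNIV \<and> p \<in> Op P (length xs)}"
    using assms(2) by (intro inj_onI) (auto simp: inj_eq dest: inj_onD)
  then show ?thesis
    unfolding und_obj_def by (rule ex_inj_on_quotient)
qed

lemma induced_coding_exists:
  fixes P :: "('p, 'l) lambda_operad_data" and i :: "'p \<Rightarrow> 'u"
  assumes inf: "infinite (UNIV :: 'u set)" and i: "inj_on i (\<Union>n. Op P n)"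
  shows "\<exists>d :: (('p \<times> (nat \<Rightarrow> nat)) set \<times> 'u list) set \<Rightarrow> 'u.
    inj_on d (und_obj Symm (induced L P) UNIV)"
proof -
  obtain f :: "'u list \<Rightarrow> 'u" where f: "inj f"
    using ex_inj_list[OF inf] by blast
  obtain e :: "nat \<Rightarrow> 'u" where e: "inj e"
    using infinite_countable_subset[OF inf] by blast
  define h where "h = (\<lambda>(n, p, \<tau>). f (i p # map (e \<circ> \<tau>) [0..<n]))"
  have h: "inj_on h (SIGMA n:UNIV. Op P n \<times> Op Symm n)"
  proof (rule inj_onI, clarsimp simp: h_def inj_eq[OF f])
    fix n p \<tau> n' p' \<tau>'
    assume p: "p \<in> Op P n" "p' \<in> Op P n'" and \<tau>: "\<tau> \<in> Op Symm n" "\<tau>' \<in> Op Symm n'"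
      and eq: "i p = i p'" "map (e \<circ> \<tau>) [0..<n] = map (e \<circ> \<tau>') [0..<n']"
    have "n = n'"
      using arg_cong[OF eq(2), of length] by simp
    moreover have "p = p'"
      using i p eq(1) by (auto dest: inj_onD)
    moreover have "\<tau> m = \<tau>' m" for m
    proof (cases "m < n")
      case True
      then show ?thesis
        using eq(2) \<open>n = n'\<close> e by (simp add: inj_eq)
    next
      case False
      then show ?thesis
        using \<tau> \<open>n = n'\<close> by (simp add: Symm_def permutes_def)
    qed
    ultimately show "n = n' \<and> p = p' \<and> \<tau> = \<tau>'"
      by auto
  qed
  have "\<exists>z. z \<in> (SIGMA n:UNIV. Op P n \<times> Op Symm n) \<and> C = ind_rel L P (fst z) `` {snd z}"
    if "C \<in> (\<Union>n. Op (induced L P) n)" for C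
  proof -
    from that obtain n where "C \<in> (Op P n \<times> Op Symm n) // ind_rel L P n"
      by (auto simp: induced_def)
    then obtain w where "w \<in> Op P n \<times> Op Symm n" "C = ind_rel L P n `` {w}"
      by (rule quotientE)
    then show ?thesis
      by (intro exI[of _ "(n, w)"]) simp
  qed
  then have "\<exists>s. \<forall>C\<in>\<Union>n. Op (induced L P) n. s C \<in> (SIGMA n:UNIV. Op P n \<times> Op Symm n) \<and>
      C = ind_rel L P (fst (s C)) `` {snd (s C)}"
    by (intro bchoice ballI)
  then obtain s where s: "\<And>C. C \<in> (\<Union>n. Op (induced L P) n) \<Longrightarrow>
      s C \<in> (SIGMA n:UNIV. Op P n \<times> Op Symm n) \<and> C = ind_rel L P (fst (s C)) `` {snd (s C)}"
    by blast
  have "inj_on (h \<circ> s) (\<Union>n. Op (induced L P) n)"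
  proof (rule inj_onI)
    fix C D
    assume C: "C \<in> (\<Union>n. Op (induced L P) n)" and D: "D \<in> (\<Union>n. Op (induced L P) n)"
      and "(h \<circ> s) C = (h \<circ> s) D"
    then have "s C = s D"
      using inj_onD[OF h] s[OF C] s[OF D] by simp
    then show "C = D"
      using s[OF C] s[OF D] by simp
  qed
  then show ?thesis
    using und_coding_exists[OF inf] by blast
qed

end

(* The bijection sends [[p, t]; x] to [p; t x], with inverse [p; x] |-> [[p, id]; x]. It respects
   the multiplications because the block permutation mu(t; t_1, ..., t_n) takes the concatenation of
   x_1, ..., x_n to the concatenation of the t-permuted list of the t_i x_i. Both monads thus have
   elements named by the same pairs (p, x), with the same identifications of names and the same
   unit and multiplication on names; the monad laws follow from the operad laws of P in terms of
   names only. In particular neither the operad laws of the induced operad nor those of the symmetric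
   groups are needed. *)

theory Submission
  imports Defs
begin

section \<open>Block permutations acting on lists\<close>

text \<open>Multiplication in both monads and in the induced operad is defined through arbitrary
  representatives, and for an element of \<open>T (T X)\<close> the choice enters twice: for the
  outer class and for each entry. Changing the outer representative by \<open>g\<close> permutes
  entries that are themselves classes, so the new inner representatives agree with the permuted old
  ones only up to equivalence. Invariance of the composite is therefore split into an outer change,
  governed by \<open>delta_op\<close>, and an inner one, governed by \<open>beta_op\<close>;
  \<open>proj_mu\<close> turns both into permutations from \<open>Symm\<close>, whose effect on
  lists is all that has to be known. For the induced operad the problem is not solved afresh:
  \<open>unind_pair\<close> uses the very representatives that the induced multiplication picks,
  which reduces its composites to those of \<open>P\<close>. The tensor product over the groups
  enters in the injectivity of the bijection: if \<open>[q, id] = [p, t]\<close>, then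
  \<open>t\<close> is the permutation of some \<open>g\<close> with \<open>q = p g\<close>.\<close>

lemma length_lact [simp]: "length (lact \<sigma> xs) = length xs"
  by (simp add: lact_def)

lemma lact_id [simp]: "lact id xs = xs"
  by (simp add: lact_def)

lemma lact_nth:
  assumes "\<sigma> permutes {..<length xs}" "i < length xs"
  shows "lact \<sigma> xs ! \<sigma> i = xs ! i"
  using assms permutes_in_image[OF assms(1)] permutes_inv[OF assms(1)]
  by (simp add: lact_def permute_list_nth permutes_inverses)

text \<open>Every position has the form \<open>\<sigma> i\<close>, so the entries there determine
  the permuted list, and the inverse inside \<open>lact\<close> never has to be computed.\<close>

lemma lact_eqI:
  assumes \<sigma>: "\<sigma> permutes {..<length xs}" and len: "length ys = length xs"
    and nth: "\<And>i. i < length xs \<Longrightarrow> ys ! \<sigma> i = xs ! i"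
  shows "lact \<sigma> xs = ys"
proof (rule nth_equalityI)
  fix j assume "j < length (lact \<sigma> xs)"
  then have "j \<in> \<sigma> ` {..<length xs}"
    using permutes_image[OF \<sigma>] by simp
  then obtain i where "i < length xs" "j = \<sigma> i"
    by blast
  then show "lact \<sigma> xs ! j = ys ! j"
    using nth lact_nth[OF \<sigma>] by simp
qed (simp add: len)

lemma lact_map:
  assumes "\<sigma> permutes {..<length xs}"
  shows "lact \<sigma> (map f xs) = map f (lact \<sigma> xs)"
  using permutes_inv[OF assms] by (simp add: lact_def permute_list_map)

lemma set_lact [simp]:
  assumes "\<sigma> permutes {..<length xs}"
  shows "set (lact \<sigma> xs) = set xs"
  using permutes_inv[OF assms] by (simp add: lact_def)

lemma lact_in_lists_iff:
  assumes "\<sigma> permutes {..<length xs}"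
  shows "lact \<sigma> xs \<in> lists X \<longleftrightarrow> xs \<in> lists X"
  using assms by (simp add: in_lists_conv_set)

lemma lact_comp:
  assumes "\<sigma> permutes {..<length xs}" "\<tau> permutes {..<length xs}"
  shows "lact (\<sigma> \<circ> \<tau>) xs = lact \<sigma> (lact \<tau> xs)"
  using assms permutes_in_image[OF assms(2)]
  by (intro lact_eqI) (auto simp: permutes_compose lact_nth)

section \<open>Blocks of a concatenation and their positions\<close>

lemma concat_nth_block:
  assumes "i < length xss" "a < length (xss ! i)"
  shows "concat xss ! (sum_list (take i (map length xss)) + a) = xss ! i ! a"
  using assms
proof (induction xss arbitrary: i)
  case (Cons xs xss)
  then show ?case
    by (cases i) (auto simp: nth_append add.assoc)
qed simp

lemma blk_less_length:
  assumes "m < sum_list ks"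
  shows "blk ks m < length ks"
proof -
  have "ks \<noteq> []" using assms by auto
  then have "blk ks m \<le> length ks - 1"
    unfolding blk_def using assms by (intro Least_le) simp
  then show ?thesis
    using \<open>ks \<noteq> []\<close> by (cases ks) auto
qed

text \<open>Minimality of \<open>blk ks m\<close> forces the block to start at or before
  \<open>m\<close>, so the truncated subtraction in \<open>off\<close> loses nothing.\<close>

lemma blk_off:
  assumes "m < sum_list ks"
  shows "m = sum_list (take (blk ks m) ks) + off ks m" "off ks m < ks ! blk ks m"
proof -
  have lt: "m < sum_list (take (Suc (blk ks m)) ks)"
    unfolding blk_def by (rule LeastI[of _ "length ks"]) (simp add: assms)
  have ge: "sum_list (take (blk ks m) ks) \<le> m"
  proof (cases "blk ks m")
    case (Suc j)
    then have "j < (LEAST i. m < sum_list (take (Suc i) ks))"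
      unfolding blk_def by simp
    from not_less_Least[OF this] show ?thesis
      using Suc by simp
  qed simp
  show "m = sum_list (take (blk ks m) ks) + off ks m"
    using ge by (simp add: off_def)
  then show "off ks m < ks ! blk ks m"
    using lt blk_less_length[OF assms] by (simp add: take_Suc_conv_app_nth)
qed

lemma block_less_sum_list:
  fixes ks :: "nat list"
  assumes "i < length ks" "a < ks ! i"
  shows "sum_list (take i ks) + a < sum_list ks"
proof -
  have "sum_list (take i ks) + a < sum_list (take (Suc i) ks)"
    using assms by (simp add: take_Suc_conv_app_nth)
  also have "\<dots> \<le> sum_list (take (Suc i) ks) + sum_list (drop (Suc i) ks)"
    by simp
  also have "\<dots> = sum_list ks"
    by (metis append_take_drop_id sum_list_append)
  finally show ?thesis .
qed

text \<open>Bijectivity is read off the effect on the list \<open>[0..<n]\<close>, so that for block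
  permutations only their action on lists has to be computed.\<close>

lemma permutes_if_moves_entries:
  assumes outside: "\<And>m. m \<ge> n \<Longrightarrow> f m = m"
    and less: "\<And>m. m < n \<Longrightarrow> f m < n"
    and nth: "\<And>m. m < n \<Longrightarrow> ys ! f m = (m :: nat)"
  shows "f permutes {..<n}"
proof -
  have "inj_on f {..<n}"
    by (rule inj_onI) (metis lessThan_iff nth)
  moreover have "f ` {..<n} \<subseteq> {..<n}"
    using less by auto
  ultimately have "bij_betw f {..<n} {..<n}"
    by (simp add: bij_betw_def endo_inj_surj)
  then show ?thesis
    using outside by (intro bij_imp_permutes) auto
qed

text \<open>With \<open>n = 0\<close> this is a test list for
  \<open>permutes_if_moves_entries\<close>: cut into blocks of lengths \<open>ks\<close>, it has
  \<open>m\<close> at position \<open>m\<close>, so its entries are distinct. The start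
  \<open>n\<close> is free for the sake of the induction.\<close>

lemma ex_split_upt:
  fixes ks :: "nat list"
  shows "\<exists>xss. map length xss = ks \<and> concat xss = [n..<n + sum_list ks]"
proof (induction ks arbitrary: n)
  case (Cons k ks)
  obtain xss where "map length xss = ks" "concat xss = [n + k..<n + k + sum_list ks]"
    using Cons by blast
  moreover have "[n..<n + k + sum_list ks] = [n..<n + k] @ [n + k..<n + k + sum_list ks]"
    by (rule upt_add_eq_append) simp
  ultimately show ?case
    by (intro exI[of _ "[n..<n + k] # xss"]) (simp add: add.assoc)
qed simp

text \<open>Serves twice: on the test list it yields the bijectivity of \<open>block_sum\<close>,
  and on arbitrary lists the action on them. It therefore must not presuppose that
  \<open>block_sum\<close> is a permutation.\<close>

lemma block_sum_moves:
  assumes \<tau>s: "list_all2 (\<lambda>\<tau> k. \<tau> permutes {..<k}) \<tau>s ks" and ks: "ks = map length xss"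
    and m: "m < sum_list ks"
  shows "block_sum ks \<tau>s m < sum_list ks"
    "concat (map2 lact \<tau>s xss) ! block_sum ks \<tau>s m = concat xss ! m"
proof -
  let ?i = "blk ks m" and ?a = "off ks m"
  have i: "?i < length ks" and a: "?a < ks ! ?i"
    using blk_less_length[OF m] blk_off(2)[OF m] .
  have perm: "(\<tau>s ! ?i) permutes {..<ks ! ?i}" and len: "length \<tau>s = length ks"
    using \<tau>s i by (auto simp: list_all2_conv_all_nth)
  have \<tau>a: "(\<tau>s ! ?i) ?a < ks ! ?i"
    using permutes_in_image[OF perm] a by simp
  show "block_sum ks \<tau>s m < sum_list ks"
    using m block_less_sum_list[OF i \<tau>a] by (simp add: block_sum_def)
  have lens: "map length (map2 lact \<tau>s xss) = ks"
    using len ks by (intro nth_equalityI) auto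
  have "concat (map2 lact \<tau>s xss) ! block_sum ks \<tau>s m = lact (\<tau>s ! ?i) (xss ! ?i) ! (\<tau>s ! ?i) ?a"
    using concat_nth_block[of ?i "map2 lact \<tau>s xss" "(\<tau>s ! ?i) ?a"] lens i \<tau>a len m ks
    by (simp add: block_sum_def)
  also have "\<dots> = xss ! ?i ! ?a"
    using perm a i ks by (intro lact_nth) auto
  also have "\<dots> = concat xss ! m"
    using concat_nth_block[of ?i xss ?a] blk_off(1)[OF m] i a ks by simp
  finally show "concat (map2 lact \<tau>s xss) ! block_sum ks \<tau>s m = concat xss ! m" .
qed

lemma block_sum_permutes:
  assumes "list_all2 (\<lambda>\<tau> k. \<tau> permutes {..<k}) \<tau>s ks"
  shows "block_sum ks \<tau>s permutes {..<sum_list ks}"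
proof -
  obtain xss where xss: "map length xss = ks" "concat xss = [0..<sum_list ks]"
    using ex_split_upt[of ks 0] by auto
  show ?thesis
    by (rule permutes_if_moves_entries[where ys = "concat (map2 lact \<tau>s xss)"])
      (use block_sum_moves[OF assms xss(1)[symmetric]] xss(2) in \<open>auto simp: block_sum_def\<close>)
qed

lemma lact_block_sum:
  assumes "list_all2 (\<lambda>\<tau> k. \<tau> permutes {..<k}) \<tau>s ks" and "ks = map length xss"
  shows "lact (block_sum ks \<tau>s) (concat xss) = concat (map2 lact \<tau>s xss)"
proof (rule lact_eqI)
  have "map length (map2 lact \<tau>s xss) = ks"
    using assms by (intro nth_equalityI) (auto dest: list_all2_lengthD)
  then show "length (concat (map2 lact \<tau>s xss)) = length (concat xss)"
    using assms(2) by (simp add: length_concat)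
qed (use assms block_sum_permutes[OF assms(1)] block_sum_moves(2)[OF assms] in
    \<open>auto simp: length_concat\<close>)

lemma block_perm_moves:
  assumes \<sigma>: "\<sigma> permutes {..<length ks}" and ks: "ks = map length xss"
    and m: "m < sum_list ks"
  shows "block_perm ks \<sigma> m < sum_list ks"
    "concat (lact \<sigma> xss) ! block_perm ks \<sigma> m = concat xss ! m"
proof -
  let ?i = "blk ks m" and ?a = "off ks m"
  have i: "?i < length ks" and a: "?a < ks ! ?i"
    using blk_less_length[OF m] blk_off(2)[OF m] .
  have \<sigma>i: "\<sigma> ?i < length ks"
    using permutes_in_image[OF \<sigma>] i by simp
  have len: "length ks = length xss"
    using ks by simp
  have lens: "map length (lact \<sigma> xss) = lact \<sigma> ks"
    using lact_map[of \<sigma> xss length] \<sigma> ks by simp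
  \<comment> \<open>The sum in \<open>block_perm\<close> runs over the blocks that land before block
    \<open>?i\<close>. Reindexed along \<open>\<sigma>\<close>, it becomes the start of block
    \<open>\<sigma> ?i\<close> in the permuted list of lengths.\<close>
  have "sum_list (take (\<sigma> ?i) (lact \<sigma> ks)) = (\<Sum>j<\<sigma> ?i. lact \<sigma> ks ! j)"
    using \<sigma>i by (simp add: sum_list_sum_nth atLeast0LessThan)
  also have "\<dots> = (\<Sum>i\<in>{i. i < length ks \<and> \<sigma> i < \<sigma> ?i}. ks ! i)"
  proof (rule sum.reindex_bij_betw_not_neutral[where S' = "{}" and T' = "{}", symmetric, THEN trans])
    show "bij_betw \<sigma> ({i. i < length ks \<and> \<sigma> i < \<sigma> ?i} - {}) ({..<\<sigma> ?i} - {})"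
    proof (simp, rule bij_betw_imageI)
      show "inj_on \<sigma> {i. i < length ks \<and> \<sigma> i < \<sigma> ?i}"
        using permutes_inj[OF \<sigma>] by (rule inj_on_subset) simp
      show "\<sigma> ` {i. i < length ks \<and> \<sigma> i < \<sigma> ?i} = {..<\<sigma> ?i}"
      proof (intro equalityI subsetI)
        fix j assume "j \<in> {..<\<sigma> ?i}"
        moreover from this have "j \<in> \<sigma> ` {..<length ks}"
          using \<sigma>i permutes_image[OF \<sigma>] by auto
        ultimately show "j \<in> \<sigma> ` {i. i < length ks \<and> \<sigma> i < \<sigma> ?i}"
          by auto
      qed auto
    qed
    show "(\<Sum>x | x < length ks \<and> \<sigma> x < \<sigma> ?i. lact \<sigma> ks ! \<sigma> x) =
        (\<Sum>i | i < length ks \<and> \<sigma> i < \<sigma> ?i. ks ! i)"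
      using lact_nth[OF \<sigma>] by (intro sum.cong) auto
  qed auto
  finally have pos: "block_perm ks \<sigma> m = sum_list (take (\<sigma> ?i) (lact \<sigma> ks)) + ?a"
    using m by (simp add: block_perm_def)
  have ki: "lact \<sigma> ks ! \<sigma> ?i = ks ! ?i"
    using lact_nth[OF \<sigma> i] .
  have "sum_list (lact \<sigma> ks) = sum_list ks"
    using permutes_inv[OF \<sigma>] by (metis lact_def mset_permute_list sum_mset_sum_list)
  then show "block_perm ks \<sigma> m < sum_list ks"
    using block_less_sum_list[of "\<sigma> ?i" "lact \<sigma> ks" ?a] \<sigma>i ki a pos by simp
  have xi: "lact \<sigma> xss ! \<sigma> ?i = xss ! ?i"
    using lact_nth[of \<sigma> xss] \<sigma> i len by simp
  have "concat (lact \<sigma> xss) ! block_perm ks \<sigma> m = xss ! ?i ! ?a"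
    using concat_nth_block[of "\<sigma> ?i" "lact \<sigma> xss" ?a] lens \<sigma>i i a ks len xi pos by simp
  also have "\<dots> = concat xss ! m"
    using concat_nth_block[of ?i xss ?a] blk_off(1)[OF m] i a ks by simp
  finally show "concat (lact \<sigma> xss) ! block_perm ks \<sigma> m = concat xss ! m" .
qed

lemma block_perm_permutes:
  assumes "\<sigma> permutes {..<length ks}"
  shows "block_perm ks \<sigma> permutes {..<sum_list ks}"
proof -
  obtain xss where xss: "map length xss = ks" "concat xss = [0..<sum_list ks]"
    using ex_split_upt[of ks 0] by auto
  show ?thesis
    by (rule permutes_if_moves_entries[where ys = "concat (lact \<sigma> xss)"])
      (use block_perm_moves[OF assms xss(1)[symmetric]] xss(2) in \<open>auto simp: block_perm_def\<close>)
qed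

lemma lact_block_perm:
  assumes "\<sigma> permutes {..<length ks}" and "ks = map length xss"
  shows "lact (block_perm ks \<sigma>) (concat xss) = concat (lact \<sigma> xss)"
proof (rule lact_eqI)
  have "mset (lact \<sigma> xss) = mset xss"
    using permutes_inv[OF assms(1)] assms(2) by (simp add: lact_def)
  then show "length (concat (lact \<sigma> xss)) = length (concat xss)"
    by (metis length_concat mset_map sum_mset_sum_list)
qed (use assms block_perm_permutes[OF assms(1)] block_perm_moves(2)[OF assms] in
    \<open>auto simp: length_concat\<close>)

lemma Op_Symm [simp]: "\<sigma> \<in> Op Symm n \<longleftrightarrow> \<sigma> permutes {..<n}"
  by (simp add: Symm_def)

lemma mu_Symm_permutes:
  assumes "\<sigma> permutes {..<length ks}" "list_all2 (\<lambda>\<tau> k. \<tau> permutes {..<k}) \<tau>s ks"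
  shows "mu Symm ks \<sigma> \<tau>s permutes {..<sum_list ks}"
  using assms by (simp add: Symm_def permutes_compose block_perm_permutes block_sum_permutes)

text \<open>The inner permutations act first. They preserve lengths, so the result is still cut at
  \<open>ks\<close> when the outer permutation moves whole blocks.\<close>

lemma lact_mu_Symm:
  assumes "\<sigma> permutes {..<length ks}" "list_all2 (\<lambda>\<tau> k. \<tau> permutes {..<k}) \<tau>s ks"
    and ks: "ks = map length xss"
  shows "lact (mu Symm ks \<sigma> \<tau>s) (concat xss) = concat (lact \<sigma> (map2 lact \<tau>s xss))"
proof -
  have "map length (map2 lact \<tau>s xss) = ks"
    using assms by (intro nth_equalityI) (auto dest: list_all2_lengthD)
  then have "lact (block_perm ks \<sigma>) (concat (map2 lact \<tau>s xss)) = concat (lact \<sigma> (map2 lact \<tau>s xss))"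
    using lact_block_perm assms(1) by metis
  moreover have "lact (mu Symm ks \<sigma> \<tau>s) (concat xss) =
      lact (block_perm ks \<sigma>) (lact (block_sum ks \<tau>s) (concat xss))"
    using block_perm_permutes[OF assms(1)] block_sum_permutes[OF assms(2)] ks
    by (simp add: Symm_def length_concat lact_comp)
  ultimately show ?thesis
    using lact_block_sum[OF assms(2,3)] by simp
qed

section \<open>Monads presented by an operad\<close>

lemma map_in_lists: "\<lbrakk>xs \<in> lists A; \<And>x. x \<in> A \<Longrightarrow> f x \<in> B\<rbrakk> \<Longrightarrow> map f xs \<in> lists B"
  by (induction xs) auto

section \<open>The category of sets, functors and isomorphisms of categories\<close>

lemma Sets_simps [simp]:
  "Ob Sets = UNIV" "Hom Sets X Y = X \<rightarrow>\<^sub>E Y" "Idn Sets X = (\<lambda>x\<in>X. x)"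
  "Cmp Sets X Y Z g f = compose X g f"
  by (simp_all add: Sets_def)

lemma Idn_Sets_PiE: "(\<lambda>x\<in>X. x) \<in> X \<rightarrow>\<^sub>E X"
  by auto

lemma compose_PiE: "\<lbrakk>f \<in> X \<rightarrow>\<^sub>E Y; g \<in> Y \<rightarrow>\<^sub>E Z\<rbrakk> \<Longrightarrow> compose X g f \<in> X \<rightarrow>\<^sub>E Z"
  by (auto simp: compose_def)

lemma compose_Idn_right: "f \<in> X \<rightarrow>\<^sub>E Y \<Longrightarrow> compose X f (\<lambda>x\<in>X. x) = f"
  by (intro ext) (auto simp: compose_def)

lemma compose_Idn_left: "f \<in> X \<rightarrow>\<^sub>E Y \<Longrightarrow> compose X (\<lambda>y\<in>Y. y) f = f"
  by (intro ext) (auto simp: compose_def)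

lemma compose_compose: "f \<in> W \<rightarrow>\<^sub>E X \<Longrightarrow> compose W h (compose W g f) = compose W (compose X h g) f"
  by (intro ext) (auto simp: compose_def)

lemma cat_Sets: "cat Sets"
  by unfold_locales
    (auto simp: compose_PiE compose_compose compose_Idn_left compose_Idn_right)

lemma fctr_id: "cat C \<Longrightarrow> fctr C C id_fctr"
  by (simp add: fctr_def fctr_axioms_def id_fctr_def)

lemma fctr_comp:
  assumes "fctr C D F" "fctr D E G"
  shows "fctr C E (comp_fctr G F)"
proof -
  interpret F: fctr C D F by fact
  interpret G: fctr D E G by fact
  show ?thesis
    by unfold_locales
      (auto simp: comp_fctr_def F.FOb_Ob G.FOb_Ob F.FHom_Hom G.FHom_Hom
        F.FHom_Idn G.FHom_Idn F.FHom_Cmp G.FHom_Cmp)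
qed

text \<open>In both uses the morphisms on either side are the same functions of underlying sets, so
  the functors leave morphisms alone and hom-sets must agree literally. The conditions for
  \<open>G\<close> follow from those for \<open>F\<close> because
  \<open>F (G Y) = Y\<close>.\<close>

lemma isomorphic_catsI:
  assumes "cat C" "cat D"
    and F: "\<And>X. X \<in> Ob C \<Longrightarrow> F X \<in> Ob D" and G: "\<And>Y. Y \<in> Ob D \<Longrightarrow> G Y \<in> Ob C"
    and GF: "\<And>X. X \<in> Ob C \<Longrightarrow> G (F X) = X" and FG: "\<And>Y. Y \<in> Ob D \<Longrightarrow> F (G Y) = Y"
    and Hom: "\<And>X Y. \<lbrakk>X \<in> Ob C; Y \<in> Ob C\<rbrakk> \<Longrightarrow> Hom D (F X) (F Y) = Hom C X Y"
    and Idn: "\<And>X. X \<in> Ob C \<Longrightarrow> Idn D (F X) = Idn C X"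
    and Cmp: "\<And>X Y Z. \<lbrakk>X \<in> Ob C; Y \<in> Ob C; Z \<in> Ob C\<rbrakk> \<Longrightarrow>
      Cmp D (F X) (F Y) (F Z) = Cmp C X Y Z"
  shows "isomorphic_cats C D"
  unfolding isomorphic_cats_def
proof (intro exI conjI)
  have Hom': "Hom C (G X) (G Y) = Hom D X Y" if "X \<in> Ob D" "Y \<in> Ob D" for X Y
    using Hom[OF G[OF that(1)] G[OF that(2)]] that FG by simp
  have Idn': "Idn C (G X) = Idn D X" if "X \<in> Ob D" for X
    using Idn[OF G[OF that]] that FG by simp
  have Cmp': "Cmp C (G X) (G Y) (G Z) = Cmp D X Y Z" if "X \<in> Ob D" "Y \<in> Ob D" "Z \<in> Ob D" for X Y Z
    using Cmp[OF G[OF that(1)] G[OF that(2)] G[OF that(3)]] that FG by simp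
  show "fctr C D \<lparr>FOb = F, FHom = (\<lambda>X Y f. f)\<rparr>"
    using assms(1,2) by (simp add: fctr_def fctr_axioms_def F Hom Idn Cmp)
  show "fctr D C \<lparr>FOb = G, FHom = (\<lambda>X Y f. f)\<rparr>"
    using assms(1,2) by (simp add: fctr_def fctr_axioms_def G Hom' Idn' Cmp')
qed (simp_all add: comp_fctr_def GF FG)

lemma (in mnd) cat_mnd_alg: "cat (mnd_alg C T)"
proof -
  note hom = Idn_Hom Cmp_Hom unit.tgt.FOb_Ob unit.tgt.FHom_Hom unit.tgt.FHom_Idn unit.tgt.FHom_Cmp
  show ?thesis
  proof (unfold_locales, goal_cases)
    case (1 X)
    then show ?case
      by (auto simp: mnd_alg_def hom Cmp_Idn_left Cmp_Idn_right)
  next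
    case (2 X Y Z f g)
    obtain A a B b D d where X: "X = (A, a)" "Y = (B, b)" "Z = (D, d)"
      by (metis prod.exhaust)
    have ob: "A \<in> Ob C" "B \<in> Ob C" "D \<in> Ob C" "TOb T A \<in> Ob C" "TOb T B \<in> Ob C" "TOb T D \<in> Ob C"
      and a: "a \<in> Hom C (TOb T A) A" "b \<in> Hom C (TOb T B) B" "d \<in> Hom C (TOb T D) D"
      and f: "f \<in> Hom C A B" "g \<in> Hom C B D"
      and eqs: "Cmp C (TOb T A) A B f a = Cmp C (TOb T A) (TOb T B) B b (THom T A B f)"
        "Cmp C (TOb T B) B D g b = Cmp C (TOb T B) (TOb T D) D d (THom T B D g)"
      using 2 unit.tgt.FOb_Ob by (auto simp: mnd_alg_def X)
    note Tf = unit.tgt.FHom_Hom[OF ob(1,2) f(1)] and Tg = unit.tgt.FHom_Hom[OF ob(2,3) f(2)]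
    have "Cmp C (TOb T A) A D (Cmp C A B D g f) a = Cmp C (TOb T A) B D g (Cmp C (TOb T A) A B f a)"
      using Cmp_assoc[OF ob(4) ob(1-3) a(1) f] by simp
    also have "\<dots> = Cmp C (TOb T A) (TOb T B) D (Cmp C (TOb T B) B D g b) (THom T A B f)"
      unfolding eqs(1) by (rule Cmp_assoc[OF ob(4,5,2,3) Tf a(2) f(2)])
    also have "\<dots> = Cmp C (TOb T A) (TOb T D) D d
        (Cmp C (TOb T A) (TOb T B) (TOb T D) (THom T B D g) (THom T A B f))"
      unfolding eqs(2) by (rule Cmp_assoc[OF ob(4,5,6,3) Tf Tg a(3), symmetric])
    finally show ?case
      using ob f by (simp add: mnd_alg_def X hom)
  next
    case (3 X Y f)
    then show ?case
      by (auto simp: mnd_alg_def Cmp_Idn_right)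
  next
    case (4 X Y f)
    then show ?case
      by (auto simp: mnd_alg_def Cmp_Idn_left)
  next
    case (5 W X Y Z f g h)
    then show ?case
      by (auto simp: mnd_alg_def Cmp_assoc)
  qed
qed

definition und_pairs :: "('p, 'z) operad_data_scheme \<Rightarrow> 'x set \<Rightarrow> ('p \<times> 'x list) set" where
  "und_pairs P X = {(p, xs). xs \<in> lists X \<and> p \<in> Op P (length xs)}"

lemma und_pairs_iff [simp]: "(p, xs) \<in> und_pairs P X \<longleftrightarrow> xs \<in> lists X \<and> p \<in> Op P (length xs)"
  by (simp add: und_pairs_def)

text \<open>The multiplication of the monad that sends \<open>X\<close> to
  \<open>und_pairs P X\<close>, that is, of the operad before dividing by group actions. Its monad
  laws are \<open>comp_pair_ident\<close>, \<open>comp_pair_ident_right\<close> and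
  \<open>comp_pair_assoc\<close>; the monads of the theorem inherit theirs from these.\<close>

definition comp_pair ::
  "('p, 'z) operad_data_scheme \<Rightarrow> 'p \<Rightarrow> ('p \<times> 'x list) list \<Rightarrow> 'p \<times> 'x list" where
  "comp_pair P p zs = (mu P (map (length \<circ> snd) zs) p (map fst zs), concat (map snd zs))"

lemma und_pairs_mono: "X \<subseteq> Y \<Longrightarrow> und_pairs P X \<subseteq> und_pairs P Y"
  by (auto simp: und_pairs_def)

lemma in_Ops_und_pairs: "zs \<in> lists (und_pairs P X) \<Longrightarrow> in_Ops P (map (length \<circ> snd) zs) (map fst zs)"
  by (induction zs) auto

lemma (in operad) comp_pair_in:
  assumes "p \<in> Op Q (length zs)" "zs \<in> lists (und_pairs Q X)"
  shows "comp_pair Q p zs \<in> und_pairs Q X"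
proof -
  have "concat (map snd zs) \<in> lists X"
    using assms(2) by (fastforce simp: in_lists_conv_set)
  then show ?thesis
    using mu_Op[of p "map (length \<circ> snd) zs" "map fst zs"] in_Ops_und_pairs[OF assms(2)] assms(1)
    by (simp add: comp_pair_def length_concat)
qed

lemma (in operad) comp_pair_ident: "z \<in> und_pairs Q X \<Longrightarrow> comp_pair Q (ident Q) [z] = z"
  using mu_ident_left by (cases z) (simp add: comp_pair_def)

lemma (in operad) comp_pair_ident_right:
  assumes "p \<in> Op Q (length xs)"
  shows "comp_pair Q p (map (\<lambda>x. (ident Q, [x])) xs) = (p, xs)"
proof -
  have "map (length \<circ> snd) (map (\<lambda>x. (ident Q, [x])) xs) = replicate (length xs) 1"
    "map fst (map (\<lambda>x. (ident Q, [x])) xs) = replicate (length xs) (ident Q)"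
    "concat (map snd (map (\<lambda>x. (ident Q, [x])) xs)) = xs"
    by (induction xs) auto
  then show ?thesis
    using mu_ident_right[OF assms] unfolding comp_pair_def by simp
qed

text \<open>Associativity of the operad settles the first components, associativity of concatenation
  the second.\<close>

lemma (in operad) comp_pair_assoc:
  assumes "p \<in> Op Q (length zs)" "zs \<in> lists (und_pairs Q (und_pairs Q X))"
  shows "comp_pair Q (fst (comp_pair Q p zs)) (snd (comp_pair Q p zs)) =
    comp_pair Q p (map (\<lambda>(q, ws). comp_pair Q q ws) zs)"
proof -
  \<comment> \<open>The arities and the operations of the innermost level, nested in the shape that
    \<open>mu_assoc\<close> expects.\<close>
  let ?lss = "map (map (length \<circ> snd) \<circ> snd) zs" and ?rss = "map (map fst \<circ> snd) zs"
  have len: "map length ?lss = map (length \<circ> snd) zs"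
    by simp
  have 1: "in_Ops Q (map length ?lss) (map fst zs)"
    using in_Ops_und_pairs[OF assms(2)] unfolding len .
  have 2: "list_all2 (\<lambda>rs ls. in_Ops Q ls rs) ?rss ?lss"
  proof (use assms(2) in \<open>induction zs\<close>)
    case (Cons z zs)
    then show ?case
      using in_Ops_und_pairs[of "snd z" Q X] by (cases z) (simp add: comp_def)
  qed simp
  let ?zs = "map (\<lambda>(q, ws). comp_pair Q q ws) zs"
  have mus: "map (\<lambda>(ls, q, rs). mu Q ls q rs) (zip ?lss (zip (map fst zs) ?rss)) = map fst ?zs"
    by (induction zs) (auto simp: comp_pair_def comp_def)
  have sums: "map sum_list ?lss = map (length \<circ> snd) ?zs"
    by (auto simp: comp_pair_def length_concat comp_def)
  have entries: "concat (map snd (concat (map snd zs))) = concat (map snd ?zs)"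
    by (induction zs) (auto simp: comp_pair_def)
  have "mu Q (concat ?lss) (mu Q (map (length \<circ> snd) zs) p (map fst zs)) (concat ?rss) =
      mu Q (map (length \<circ> snd) ?zs) p (map fst ?zs)"
    using mu_assoc[OF _ 1 2, of p] assms(1) unfolding len mus sums by simp
  moreover have "concat ?lss = map (length \<circ> snd) (concat (map snd zs))"
    "concat ?rss = map fst (concat (map snd zs))"
    by (simp_all add: map_concat comp_def)
  ultimately show ?thesis
    using entries by (simp only: comp_pair_def[of Q p] comp_pair_def[of Q "mu _ _ _ _"] fst_conv snd_conv)
qed

text \<open>A monad all of whose elements have names \<open>K (p, xs)\<close>, for which the unit and the
  multiplication act on names. Both monads of the theorem are of this form for the same operad,
  with names that identify the same pairs.\<close>

locale presented_monad = operad P for P :: "('p, 'z) operad_data_scheme" +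
  fixes K :: "'p \<times> 'u list \<Rightarrow> 'u" and T :: "('u set, 'u \<Rightarrow> 'u) mnd"
  assumes TOb_eq: "TOb T X = K ` und_pairs P X"
    and THom_ext: "THom T X Y f \<in> extensional (TOb T X)"
    and THom_K: "\<lbrakk>f \<in> X \<rightarrow>\<^sub>E Y; (p, xs) \<in> und_pairs P X\<rbrakk> \<Longrightarrow> THom T X Y f (K (p, xs)) = K (p, map f xs)"
    and Eta_eq: "Eta T X = (\<lambda>x\<in>X. K (ident P, [x]))"
    and Mu_ext: "Mu T X \<in> extensional (TOb T (TOb T X))"
    and Mu_K: "\<lbrakk>p \<in> Op P (length zs); zs \<in> lists (und_pairs P X)\<rbrakk> \<Longrightarrow>
      Mu T X (K (p, map K zs)) = K (comp_pair P p zs)"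
begin

lemma TObI: "z \<in> und_pairs P X \<Longrightarrow> K z \<in> TOb T X"
  by (simp add: TOb_eq)

lemma TObE:
  assumes "t \<in> TOb T X"
  obtains p xs where "p \<in> Op P (length xs)" "xs \<in> lists X" "t = K (p, xs)"
  using assms by (auto simp: TOb_eq und_pairs_def)

lemma TTObI: "\<lbrakk>p \<in> Op P (length zs); zs \<in> lists (und_pairs P X)\<rbrakk> \<Longrightarrow>
    K (p, map K zs) \<in> TOb T (TOb T X)"
  by (rule TObI) (auto intro!: map_in_lists TObI)

text \<open>A name is chosen for each entry of the outer name. The result is a list of pairs, the
  form on which \<open>Mu_K\<close> computes.\<close>

lemma TTObE:
  assumes "t \<in> TOb T (TOb T X)"
  obtains p zs where "p \<in> Op P (length zs)" "zs \<in> lists (und_pairs P X)" "t = K (p, map K zs)"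
proof -
  obtain p ts where p: "p \<in> Op P (length ts)" "ts \<in> lists (TOb T X)" "t = K (p, ts)"
    using assms by (rule TObE)
  then obtain zs where "zs \<in> lists (und_pairs P X)" "ts = map K zs"
    by (auto simp: TOb_eq lists_image)
  with p that show ?thesis by simp
qed

lemma THom_PiE: "f \<in> X \<rightarrow>\<^sub>E Y \<Longrightarrow> THom T X Y f \<in> TOb T X \<rightarrow>\<^sub>E TOb T Y"
proof (rule PiE_I)
  fix t assume f: "f \<in> X \<rightarrow>\<^sub>E Y" and "t \<in> TOb T X"
  then obtain p xs where p: "p \<in> Op P (length xs)" "xs \<in> lists X" "t = K (p, xs)"
    by (rule_tac TObE)
  have "map f xs \<in> lists Y"
    using f by (intro map_in_lists[OF p(2)]) auto
  then show "THom T X Y f t \<in> TOb T Y"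
    using p f by (simp add: THom_K TObI)
qed (rule extensional_arb[OF THom_ext])

lemma Eta_PiE: "Eta T X \<in> X \<rightarrow>\<^sub>E TOb T X"
  using ident_Op by (auto simp: Eta_eq intro!: TObI)

lemma Mu_PiE: "Mu T X \<in> TOb T (TOb T X) \<rightarrow>\<^sub>E TOb T X"
proof (rule PiE_I)
  fix t assume "t \<in> TOb T (TOb T X)"
  then obtain p zs where "p \<in> Op P (length zs)" "zs \<in> lists (und_pairs P X)" "t = K (p, map K zs)"
    by (rule TTObE)
  then show "Mu T X t \<in> TOb T X"
    by (simp add: Mu_K TObI comp_pair_in)
qed (rule extensional_arb[OF Mu_ext])

lemma fctr: "fctr Sets Sets (Fn T)"
proof (intro fctr.intro cat_Sets fctr_axioms.intro, goal_cases)
  case (3 X)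
  show ?case
  proof (rule extensionalityI[of _ "TOb T X"])
    fix t assume "t \<in> TOb T X"
    then show "THom T X X (Idn Sets X) t = Idn Sets (TOb T X) t"
      by (auto elim!: TObE simp: THom_K[OF Idn_Sets_PiE] TObI in_lists_conv_set
          intro!: arg_cong[of _ _ "\<lambda>xs. K (_, xs)"] map_idI)
  qed (auto simp: THom_ext)
next
  case (4 X Y Z f g)
  then have f: "f \<in> X \<rightarrow>\<^sub>E Y" and g: "g \<in> Y \<rightarrow>\<^sub>E Z"
    by auto
  show ?case
  proof (rule extensionalityI[of _ "TOb T X"])
    fix t assume "t \<in> TOb T X"
    then obtain p xs where t: "p \<in> Op P (length xs)" "xs \<in> lists X" "t = K (p, xs)"
      by (rule TObE)
    moreover have "map f xs \<in> lists Y"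
      using f by (intro map_in_lists[OF t(2)]) auto
    moreover have "map (compose X g f) xs = map g (map f xs)"
      using t(2) by (auto simp: compose_def)
    ultimately show "THom T X Z (Cmp Sets X Y Z g f) t =
        Cmp Sets (TOb T X) (TOb T Y) (TOb T Z) (THom T Y Z g) (THom T X Y f) t"
      by (simp add: compose_eq TObI THom_K[OF f] THom_K[OF g] THom_K[OF compose_PiE[OF f g]]
          del: map_map map_eq_conv)
  qed (auto simp: THom_ext)
qed (auto simp: THom_PiE[simplified])

lemma mnd: "mnd Sets T"
proof -
  have fctr2: "fctr Sets Sets (comp_fctr (Fn T) (Fn T))"
    using fctr fctr by (rule fctr_comp)
  show ?thesis
  proof (intro mnd.intro nat_trans.intro nat_trans_axioms.intro mnd_axioms.intro
      cat_Sets fctr_id fctr fctr2, goal_cases)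
    case (1 X)
    then show ?case
      using Eta_PiE[of X] by (simp add: id_fctr_def)
  next
    case (2 X Y f)
    then have f: "f \<in> X \<rightarrow>\<^sub>E Y"
      by simp
    show ?case
    proof (rule extensionalityI[of _ X])
      fix x assume "x \<in> X"
      with f show "Cmp Sets (FOb id_fctr X) (FOb id_fctr Y) (TOb T Y) (Eta T Y)
          (FHom id_fctr X Y f) x =
          Cmp Sets (FOb id_fctr X) (TOb T X) (TOb T Y) (THom T X Y f) (Eta T X) x"
        using ident_Op by (auto simp: id_fctr_def compose_eq Eta_eq THom_K[OF f])
    qed (simp_all add: id_fctr_def)
  next
    case (3 X)
    then show ?case
      using Mu_PiE[of X] by (simp add: comp_fctr_def)
  next
    case (4 X Y f)
    then have f: "f \<in> X \<rightarrow>\<^sub>E Y"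
      by simp
    have "compose (TOb T (TOb T X)) (Mu T Y) (THom T (TOb T X) (TOb T Y) (THom T X Y f)) =
        compose (TOb T (TOb T X)) (THom T X Y f) (Mu T X)"
    proof (rule extensionalityI[of _ "TOb T (TOb T X)"])
      fix t assume t: "t \<in> TOb T (TOb T X)"
      then obtain p zs where p: "p \<in> Op P (length zs)" "zs \<in> lists (und_pairs P X)"
        "t = K (p, map K zs)"
        by (rule TTObE)
      define zs' where "zs' = map (\<lambda>(q, xs). (q, map f xs)) zs"
      have zs': "zs' \<in> lists (und_pairs P Y)"
        using p(2) f by (fastforce simp: zs'_def in_lists_conv_set)
      have 1: "map (THom T X Y f) (map K zs) = map K zs'"
        using p(2) by (auto simp: zs'_def THom_K[OF f])
      \<comment> \<open>Composition only concatenates the innermost entries, so relabelling them by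
        \<open>f\<close> commutes with it.\<close>
      have 2: "comp_pair P p zs' = (fst (comp_pair P p zs), map f (snd (comp_pair P p zs)))"
        by (simp add: zs'_def comp_pair_def map_concat comp_def case_prod_unfold)
      have "map K zs \<in> lists (TOb T X)"
        using TObI by (intro map_in_lists[OF p(2)]) auto
      then have "THom T (TOb T X) (TOb T Y) (THom T X Y f) t = K (p, map K zs')"
        using p 1 THom_K[OF THom_PiE[OF f], of p "map K zs"] by simp
      moreover have "Mu T Y (K (p, map K zs')) = K (comp_pair P p zs')"
        using zs' p(1) by (intro Mu_K) (auto simp: zs'_def)
      moreover have "THom T X Y f (Mu T X t) = K (comp_pair P p zs')"
        using p comp_pair_in[OF p(1,2)] THom_K[OF f, of "fst (comp_pair P p zs)" "snd (comp_pair P p zs)"]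
        by (simp add: Mu_K 2 del: und_pairs_iff)
      ultimately show "compose (TOb T (TOb T X)) (Mu T Y)
          (THom T (TOb T X) (TOb T Y) (THom T X Y f)) t =
          compose (TOb T (TOb T X)) (THom T X Y f) (Mu T X) t"
        using t by (simp add: compose_eq)
    qed auto
    then show ?case
      by (simp add: comp_fctr_def)
  next
    case (5 X)
    show ?case
    proof (rule extensionalityI[of _ "TOb T X"])
      fix t assume t: "t \<in> TOb T X"
      then obtain p xs where p: "p \<in> Op P (length xs)" "xs \<in> lists X" "t = K (p, xs)"
        by (rule TObE)
      then have "Mu T X (K (ident P, [t])) = t"
        using Mu_K[of "ident P" "[(p, xs)]" X] comp_pair_ident[of "(p, xs)" X] ident_Op by simp
      with t show "Cmp Sets (TOb T X) (TOb T (TOb T X)) (TOb T X) (Mu T X) (Eta T (TOb T X)) t =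
          Idn Sets (TOb T X) t"
        by (simp add: compose_eq Eta_eq)
    qed auto
  next
    case (6 X)
    show ?case
    proof (rule extensionalityI[of _ "TOb T X"])
      fix t assume t: "t \<in> TOb T X"
      then obtain p xs where p: "p \<in> Op P (length xs)" "xs \<in> lists X" "t = K (p, xs)"
        by (rule TObE)
      let ?zs = "map (\<lambda>x. (ident P, [x])) xs"
      have eq: "map (Eta T X) xs = map K ?zs"
        using p(2) by (auto simp: Eta_eq)
      have "THom T X (TOb T X) (Eta T X) t = K (p, map (Eta T X) xs)"
        using p THom_K[OF Eta_PiE, of p xs X] by simp
      then have "THom T X (TOb T X) (Eta T X) t = K (p, map K ?zs)"
        unfolding eq .
      also have "Mu T X \<dots> = K (comp_pair P p ?zs)"
        using p ident_Op by (intro Mu_K) auto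
      also have "\<dots> = t"
        using comp_pair_ident_right[OF p(1)] p(3) by simp
      finally show "Cmp Sets (TOb T X) (TOb T (TOb T X)) (TOb T X) (Mu T X)
          (THom T X (TOb T X) (Eta T X)) t = Idn Sets (TOb T X) t"
        using t by (simp add: compose_eq)
    qed auto
  next
    case (7 X)
    show ?case
    proof (rule extensionalityI[of _ "TOb T (TOb T (TOb T X))"])
      fix t assume t: "t \<in> TOb T (TOb T (TOb T X))"
      then obtain p ys where p: "p \<in> Op P (length ys)" "ys \<in> lists (und_pairs P (TOb T X))"
        "t = K (p, map K ys)"
        by (rule TTObE)
      \<comment> \<open>One level deeper, the entries of the pairs \<open>ys\<close> are named in
        turn. An element of \<open>T (T (T X))\<close> is thus given by a list \<open>zs\<close> of
        pairs of pairs, to which \<open>comp_pair_assoc\<close> applies.\<close>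
      have "und_pairs P (TOb T X) = (\<lambda>(q, ws). (q, map K ws)) ` und_pairs P (und_pairs P X)"
        by (auto simp: TOb_eq lists_image image_iff und_pairs_def)
      with p(2) obtain zs where zs: "zs \<in> lists (und_pairs P (und_pairs P X))"
        "ys = map (\<lambda>(q, ws). (q, map K ws)) zs"
        by (auto simp: lists_image)
      have p': "p \<in> Op P (length zs)"
        using p(1) zs(2) by simp
      obtain r vs where r: "comp_pair P p zs = (r, vs)"
        by fastforce
      have r': "r \<in> Op P (length vs)" "vs \<in> lists (und_pairs P X)"
        using comp_pair_in[OF p' zs(1)] by (auto simp: r)
      have "comp_pair P p ys = (r, map K vs)"
        using r by (auto simp: zs(2) comp_pair_def map_concat comp_def case_prod_unfold)
      then have "Mu T X (Mu T (TOb T X) t) = K (comp_pair P r vs)"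
        using p r' by (simp add: Mu_K)
      moreover have "Mu T X (THom T (TOb T (TOb T X)) (TOb T X) (Mu T X) t) =
          K (comp_pair P p (map (\<lambda>(q, ws). comp_pair P q ws) zs))"
      proof -
        let ?zs = "map (\<lambda>(q, ws). comp_pair P q ws) zs"
        have "map (Mu T X) (map K ys) = map K ?zs"
          using zs(1) by (auto simp: zs(2) Mu_K)
        moreover have "map K ys \<in> lists (TOb T (TOb T X))"
          using TObI by (intro map_in_lists[OF p(2)]) auto
        ultimately have "THom T (TOb T (TOb T X)) (TOb T X) (Mu T X) t = K (p, map K ?zs)"
          using p THom_K[OF Mu_PiE, of p "map K ys" X] by simp
        moreover have "?zs \<in> lists (und_pairs P X)"
          by (rule map_in_lists[OF zs(1)]) (clarsimp split del: if_split simp: comp_pair_in)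
        ultimately show ?thesis
          using p' Mu_K[of p ?zs X] by (simp del: map_map)
      qed
      ultimately show "Cmp Sets (TOb T (TOb T (TOb T X))) (TOb T (TOb T X)) (TOb T X)
            (Mu T X) (Mu T (TOb T X)) t =
          Cmp Sets (TOb T (TOb T (TOb T X))) (TOb T (TOb T X)) (TOb T X)
            (Mu T X) (THom T (TOb T (TOb T X)) (TOb T X) (Mu T X)) t"
        using t comp_pair_assoc[OF p' zs(1)] r by (simp add: compose_eq)
    qed auto
  qed
qed

text \<open>The conditions involve the structure map only through \<open>a \<circ> K\<close>, so
  they can be carried over to any other monad whose elements have the same names.\<close>

lemma Ob_mnd_alg_iff:
  "(A, a) \<in> Ob (mnd_alg Sets T) \<longleftrightarrow> a \<in> TOb T A \<rightarrow>\<^sub>E A \<and> (\<forall>x\<in>A. a (K (ident P, [x])) = x) \<and>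
     (\<forall>p zs. p \<in> Op P (length zs) \<longrightarrow> zs \<in> lists (und_pairs P A) \<longrightarrow>
       a (K (comp_pair P p zs)) = a (K (p, map (a \<circ> K) zs)))"
proof (cases "a \<in> TOb T A \<rightarrow>\<^sub>E A")
  case a: True
  have "compose A a (Eta T A) = (\<lambda>x\<in>A. x) \<longleftrightarrow> (\<forall>x\<in>A. a (K (ident P, [x])) = x)"
    by (auto simp: compose_def Eta_eq fun_eq_iff restrict_def)
  moreover have "compose (TOb T (TOb T A)) a (Mu T A) =
      compose (TOb T (TOb T A)) a (THom T (TOb T A) A a) \<longleftrightarrow>
      (\<forall>t\<in>TOb T (TOb T A). a (Mu T A t) = a (THom T (TOb T A) A a t))"
    by (auto simp: compose_def fun_eq_iff restrict_def)
  moreover have "\<dots> \<longleftrightarrow> (\<forall>p zs. p \<in> Op P (length zs) \<longrightarrow> zs \<in> lists (und_pairs P A) \<longrightarrow>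
       a (K (comp_pair P p zs)) = a (K (p, map (a \<circ> K) zs)))"
  proof -
    have *: "a (Mu T A (K (p, map K zs))) = a (THom T (TOb T A) A a (K (p, map K zs))) \<longleftrightarrow>
       a (K (comp_pair P p zs)) = a (K (p, map (a \<circ> K) zs))"
      if "p \<in> Op P (length zs)" "zs \<in> lists (und_pairs P A)" for p zs
    proof -
      have "map K zs \<in> lists (TOb T A)"
        using TObI by (intro map_in_lists[OF that(2)]) auto
      then show ?thesis
        using that THom_K[OF a, of p "map K zs"] by (simp add: Mu_K)
    qed
    show ?thesis
      using * by (metis TTObE TTObI)
  qed
  ultimately show ?thesis
    using a by (simp add: mnd_alg_def)
qed (simp add: mnd_alg_def)

lemma Hom_mnd_alg_iff:
  assumes "a \<in> TOb T A \<rightarrow>\<^sub>E A" "b \<in> TOb T B \<rightarrow>\<^sub>E B"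
  shows "f \<in> Hom (mnd_alg Sets T) (A, a) (B, b) \<longleftrightarrow> f \<in> A \<rightarrow>\<^sub>E B \<and>
    (\<forall>p xs. p \<in> Op P (length xs) \<longrightarrow> xs \<in> lists A \<longrightarrow> f (a (K (p, xs))) = b (K (p, map f xs)))"
proof (cases "f \<in> A \<rightarrow>\<^sub>E B")
  case f: True
  have "compose (TOb T A) f a = compose (TOb T A) b (THom T A B f) \<longleftrightarrow>
      (\<forall>t\<in>TOb T A. f (a t) = b (THom T A B f t))"
    by (auto simp: compose_def fun_eq_iff restrict_def)
  also have "\<dots> \<longleftrightarrow> (\<forall>p xs. p \<in> Op P (length xs) \<longrightarrow> xs \<in> lists A \<longrightarrow>
      f (a (K (p, xs))) = b (K (p, map f xs)))"
    by (auto simp: TOb_eq und_pairs_def THom_K[OF f])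
  finally show ?thesis
    using f by (simp add: mnd_alg_def)
qed (simp add: mnd_alg_def)

end

section \<open>Comparison of two monads presented by the same operad\<close>

definition rename_elts ::
  "('p, 'z) operad_data_scheme \<Rightarrow> ('p \<times> 'u list \<Rightarrow> 'u) \<Rightarrow> ('p \<times> 'u list \<Rightarrow> 'u) \<Rightarrow> 'u set \<Rightarrow> 'u \<Rightarrow> 'u" where
  "rename_elts P K K' X = (\<lambda>t\<in>K ` und_pairs P X. K' (SOME z. z \<in> und_pairs P X \<and> K z = t))"

text \<open>The abstract form of the theorem: naming maps with equal kernels give isomorphic monads.
  The situation is symmetric in the two monads, so inverses come from the same lemmas with the roles
  exchanged.\<close>

locale presented_monads = A: presented_monad P K T + B: presented_monad P K' T'
  for P :: "('p, 'z) operad_data_scheme" and K K' :: "'p \<times> 'u list \<Rightarrow> 'u" and T T' +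
  assumes kernel: "\<lbrakk>z \<in> und_pairs P UNIV; z' \<in> und_pairs P UNIV\<rbrakk> \<Longrightarrow> K z = K z' \<longleftrightarrow> K' z = K' z'"
begin

abbreviation "\<phi> \<equiv> rename_elts P K K'"

text \<open>\<open>rename_elts\<close> picks some name of the element, and equal kernels make the
  result independent of the pick. Names with entries in \<open>X\<close> are also names over
  \<open>UNIV\<close>, where \<open>kernel\<close> is stated.\<close>

lemma rename_K: assumes "z \<in> und_pairs P X" shows "\<phi> X (K z) = K' z"
proof -
  let ?z = "SOME z'. z' \<in> und_pairs P X \<and> K z' = K z"
  have "?z \<in> und_pairs P X \<and> K ?z = K z"
    by (rule someI[of _ z]) (simp add: assms)
  moreover have "und_pairs P X \<subseteq> und_pairs P UNIV"
    by (rule und_pairs_mono) simp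
  ultimately have "K' ?z = K' z"
    using kernel[of ?z z] assms by blast
  then show ?thesis
    using assms by (simp add: rename_elts_def)
qed

lemma rename_PiE: "\<phi> X \<in> TOb T X \<rightarrow>\<^sub>E TOb T' X"
proof (rule PiE_I)
  show "\<phi> X t \<in> TOb T' X" if "t \<in> TOb T X" for t
    using that by (auto simp: A.TOb_eq rename_K simp del: und_pairs_iff intro!: B.TObI)
qed (simp add: rename_elts_def A.TOb_eq)

lemma presented_monads_sym: "presented_monads P K' K T' T"
  using kernel by unfold_locales simp

lemma rename_inverse: "compose (TOb T X) (rename_elts P K' K X) (\<phi> X) = (\<lambda>t\<in>TOb T X. t)"
proof -
  interpret S: presented_monads P K' K T' T
    by (rule presented_monads_sym)
  show ?thesis
  proof (rule extensionalityI[of _ "TOb T X"])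
    fix t assume t: "t \<in> TOb T X"
    then obtain z where "z \<in> und_pairs P X" "t = K z"
      by (auto simp: A.TOb_eq)
    then show "compose (TOb T X) (S.\<phi> X) (\<phi> X) t = (\<lambda>t\<in>TOb T X. t) t"
      using t by (simp add: compose_eq rename_K S.rename_K)
  qed auto
qed

text \<open>Unit, multiplication and functor act on names by formulas that are the same for both
  monads, so in each law the two sides turn out to have the same name.\<close>

lemma mnd_iso: "mnd_iso Sets T T' \<phi>"
proof (intro mnd_iso.intro nat_trans.intro nat_trans_axioms.intro mnd_iso_axioms.intro
      A.mnd B.mnd A.fctr B.fctr, goal_cases)
  case (1 X)
  then show ?case
    using rename_PiE[of X] by simp
next
  case (2 X Y f)
  then have f: "f \<in> X \<rightarrow>\<^sub>E Y"
    by simp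
  show ?case
  proof (rule extensionalityI[of _ "TOb T X"])
    fix t assume t: "t \<in> TOb T X"
    then obtain p xs where p: "p \<in> Op P (length xs)" "xs \<in> lists X" "t = K (p, xs)"
      by (rule A.TObE)
    have "map f xs \<in> lists Y"
      using f by (intro map_in_lists[OF p(2)]) auto
    with t p show "Cmp Sets (TOb T X) (TOb T Y) (TOb T' Y) (\<phi> Y) (THom T X Y f) t =
        Cmp Sets (TOb T X) (TOb T' X) (TOb T' Y) (THom T' X Y f) (\<phi> X) t"
      by (simp add: compose_eq A.THom_K[OF f] B.THom_K[OF f] rename_K)
  qed auto
next
  case (3 X)
  interpret S: presented_monads P K' K T' T
    by (rule presented_monads_sym)
  show ?case
    using rename_PiE[of X] S.rename_PiE[of X] rename_inverse[of X] S.rename_inverse[of X]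
    by (auto simp: iso_in_def)
next
  case (4 X)
  show ?case
  proof (rule extensionalityI[of _ X])
    fix x assume "x \<in> X"
    then show "Cmp Sets X (TOb T X) (TOb T' X) (\<phi> X) (Eta T X) x = Eta T' X x"
      using A.ident_Op by (simp add: compose_eq A.Eta_eq B.Eta_eq rename_K)
  qed (auto simp: B.Eta_eq)
next
  case (5 X)
  show ?case
  proof (rule extensionalityI[of _ "TOb T (TOb T X)"])
    fix t assume t: "t \<in> TOb T (TOb T X)"
    then obtain p zs where p: "p \<in> Op P (length zs)" "zs \<in> lists (und_pairs P X)" "t = K (p, map K zs)"
      by (rule A.TTObE)
    \<comment> \<open>The horizontal composite renames in two rounds: \<open>K (p, map K zs)\<close>
      becomes \<open>K (p, map K' zs)\<close>, and then \<open>K' (p, map K' zs)\<close>.\<close>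
    have eq: "map (\<phi> X) (map K zs) = map K' zs"
      using p(2) by (auto simp: rename_K)
    have "map K zs \<in> lists (TOb T X)"
      using A.TObI by (intro map_in_lists[OF p(2)]) auto
    then have "THom T (TOb T X) (TOb T' X) (\<phi> X) t = K (p, map (\<phi> X) (map K zs))"
      using p A.THom_K[OF rename_PiE, of p "map K zs"] by simp
    also note eq
    finally have "THom T (TOb T X) (TOb T' X) (\<phi> X) t = K (p, map K' zs)" .
    moreover have "map K' zs \<in> lists (TOb T' X)"
      using B.TObI by (intro map_in_lists[OF p(2)]) auto
    ultimately show "Cmp Sets (TOb T (TOb T X)) (TOb T X) (TOb T' X) (\<phi> X) (Mu T X) t =
        Cmp Sets (TOb T (TOb T X)) (TOb T' (TOb T' X)) (TOb T' X) (Mu T' X)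
          (Cmp Sets (TOb T (TOb T X)) (TOb T (TOb T' X)) (TOb T' (TOb T' X))
            (\<phi> (TOb T' X)) (THom T (TOb T X) (TOb T' X) (\<phi> X))) t"
      using t p A.comp_pair_in[OF p(1,2)] by (simp add: compose_eq rename_K A.Mu_K B.Mu_K)
  qed auto
qed

text \<open>Algebras are pulled back along the inverse isomorphism. The new structure map sends
  \<open>K' z\<close> to \<open>a (K z)\<close>, so on names it coincides with the old one and
  satisfies the same conditions.\<close>

lemma alg_transfer:
  assumes "(A, a) \<in> Ob (mnd_alg Sets T)"
  shows "(A, compose (TOb T' A) a (rename_elts P K' K A)) \<in> Ob (mnd_alg Sets T')"
proof -
  interpret S: presented_monads P K' K T' T
    by (rule presented_monads_sym)
  let ?a' = "compose (TOb T' A) a (rename_elts P K' K A)"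
  have a: "a \<in> TOb T A \<rightarrow>\<^sub>E A" and unit: "\<And>x. x \<in> A \<Longrightarrow> a (K (ident P, [x])) = x"
    and mult: "\<And>p zs. \<lbrakk>p \<in> Op P (length zs); zs \<in> lists (und_pairs P A)\<rbrakk> \<Longrightarrow>
       a (K (comp_pair P p zs)) = a (K (p, map (a \<circ> K) zs))"
    using assms unfolding A.Ob_mnd_alg_iff by auto
  have a': "?a' (K' z) = a (K z)" if "z \<in> und_pairs P A" for z
    using that B.TObI by (simp add: compose_eq S.rename_K)
  have "?a' (K' (comp_pair P p zs)) = ?a' (K' (p, map (?a' \<circ> K') zs))"
    if "p \<in> Op P (length zs)" "zs \<in> lists (und_pairs P A)" for p zs
  proof -
    have "map (?a' \<circ> K') zs = map (a \<circ> K) zs"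
      using that(2) by (auto simp: a')
    moreover have "map (a \<circ> K) zs \<in> lists A"
      using A.TObI a by (intro map_in_lists[OF that(2)]) auto
    ultimately show ?thesis
      using that A.comp_pair_in[OF that] by (simp add: a' mult del: map_map map_eq_conv)
  qed
  moreover have "?a' \<in> TOb T' A \<rightarrow>\<^sub>E A"
    using S.rename_PiE a by (rule compose_PiE)
  ultimately show ?thesis
    unfolding B.Ob_mnd_alg_iff using unit A.ident_Op by (simp add: a')
qed

lemma alg_transfer_inverse:
  assumes "(A, a) \<in> Ob (mnd_alg Sets T)"
  shows "compose (TOb T A) (compose (TOb T' A) a (rename_elts P K' K A)) (\<phi> A) = a"
proof -
  have a: "a \<in> TOb T A \<rightarrow>\<^sub>E A"
    using assms unfolding A.Ob_mnd_alg_iff by auto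
  show ?thesis
    using compose_compose[OF rename_PiE, of A a "rename_elts P K' K A"] rename_inverse[of A]
      compose_Idn_right[OF a] by simp
qed

lemma isomorphic_mnd_algs: "isomorphic_cats (mnd_alg Sets T) (mnd_alg Sets T')"
proof -
  interpret S: presented_monads P K' K T' T
    by (rule presented_monads_sym)
  let ?F = "\<lambda>(A, a). (A, compose (TOb T' A) a (rename_elts P K' K A))"
  let ?G = "\<lambda>(A, a). (A, compose (TOb T A) a (\<phi> A))"
  show ?thesis
  proof (rule isomorphic_catsI[where F = ?F and G = ?G])
    show "cat (mnd_alg Sets T)" "cat (mnd_alg Sets T')"
      using A.mnd B.mnd by (simp_all add: mnd.cat_mnd_alg)
    fix X Y assume XY: "X \<in> Ob (mnd_alg Sets T)" "Y \<in> Ob (mnd_alg Sets T)"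
    obtain A a B b where [simp]: "X = (A, a)" "Y = (B, b)"
      by fastforce
    have a: "a \<in> TOb T A \<rightarrow>\<^sub>E A" "b \<in> TOb T B \<rightarrow>\<^sub>E B"
      using XY by (auto simp: A.Ob_mnd_alg_iff)
    let ?a' = "compose (TOb T' A) a (rename_elts P K' K A)"
    let ?b' = "compose (TOb T' B) b (rename_elts P K' K B)"
    have "?a' \<in> TOb T' A \<rightarrow>\<^sub>E A" "?b' \<in> TOb T' B \<rightarrow>\<^sub>E B"
      using compose_PiE[OF S.rename_PiE] a by auto
    moreover have "?a' (K' z) = a (K z)" if "z \<in> und_pairs P A" for z
      using that B.TObI by (simp add: compose_eq S.rename_K)
    moreover have "?b' (K' z) = b (K z)" if "z \<in> und_pairs P B" for z
      using that B.TObI by (simp add: compose_eq S.rename_K)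
    moreover have "map f xs \<in> lists B" if "f \<in> A \<rightarrow>\<^sub>E B" "xs \<in> lists A" for f xs
      using that(1) by (intro map_in_lists[OF that(2)]) auto
    ultimately show "Hom (mnd_alg Sets T') (?F X) (?F Y) = Hom (mnd_alg Sets T) X Y"
      using a by (simp add: set_eq_iff A.Hom_mnd_alg_iff B.Hom_mnd_alg_iff cong: conj_cong imp_cong)
  qed (auto simp: alg_transfer S.alg_transfer alg_transfer_inverse S.alg_transfer_inverse,
      auto simp: mnd_alg_def)
qed

end

section \<open>The monad of an operad with group actions\<close>

lemma group_Symm: "group (Gr Symm n)"
proof (rule groupI)
  fix \<sigma> assume "\<sigma> \<in> carrier (Gr Symm n)"
  then have "\<sigma> permutes {..<n}"
    by (simp add: Symm_def)
  then show "\<exists>\<tau>\<in>carrier (Gr Symm n). \<tau> \<otimes>\<^bsub>Gr Symm n\<^esub> \<sigma> = \<one>\<^bsub>Gr Symm n\<^esub>"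
    using permutes_inv permutes_inv_o(2) by (fastforce simp: Symm_def)
qed (auto simp: Symm_def permutes_compose permutes_id comp_assoc)

text \<open>The part of a \<open>\<Lambda>\<close>-operad that concerns the right actions and their
  permutations, which is what the quotient is made from. It is isolated because it is instantiated
  twice: at \<open>L\<close> and \<open>P\<close>, and at \<open>Symm\<close> and the induced
  operad.\<close>

locale lambda_module =
  fixes L :: "'l action_operad_data" and P :: "('p, 'l) lambda_operad_data"
  assumes Gr_carrier: "carrier (Gr L n) = Op L n"
    and Gr_group: "group (Gr L n)"
    and proj_hom: "proj L n \<in> hom (Gr L n) (Gr Symm n)"
    and act_Op: "\<lbrakk>p \<in> Op P n; g \<in> Op L n\<rbrakk> \<Longrightarrow> act P n p g \<in> Op P n"
    and act_one: "p \<in> Op P n \<Longrightarrow> act P n p \<one>\<^bsub>Gr L n\<^esub> = p"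
    and act_mult: "\<lbrakk>p \<in> Op P n; g \<in> Op L n; h \<in> Op L n\<rbrakk> \<Longrightarrow>
      act P n p (g \<otimes>\<^bsub>Gr L n\<^esub> h) = act P n (act P n p g) h"
begin

lemma one_Op: "\<one>\<^bsub>Gr L n\<^esub> \<in> Op L n"
  using Gr_group[of n] Gr_carrier[of n] group.is_monoid monoid.one_closed by metis

lemma mult_Op: "\<lbrakk>g \<in> Op L n; h \<in> Op L n\<rbrakk> \<Longrightarrow> g \<otimes>\<^bsub>Gr L n\<^esub> h \<in> Op L n"
  using Gr_group[of n] Gr_carrier[of n] group.is_monoid monoid.m_closed by metis

lemma proj_permutes: "g \<in> Op L n \<Longrightarrow> proj L n g permutes {..<n}"
  using hom_carrier[OF proj_hom[of n]] Gr_carrier[of n] by (auto simp: Symm_def)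

lemma proj_mult: "\<lbrakk>g \<in> Op L n; h \<in> Op L n\<rbrakk> \<Longrightarrow>
    proj L n (g \<otimes>\<^bsub>Gr L n\<^esub> h) = proj L n g \<circ> proj L n h"
  using hom_mult[OF proj_hom[of n]] Gr_carrier[of n] by (simp add: Symm_def)

lemma proj_one: "proj L n \<one>\<^bsub>Gr L n\<^esub> = id"
  using hom_one[OF proj_hom Gr_group group_Symm, of n] by (simp add: Symm_def)

lemma ex_inverse:
  assumes "g \<in> Op L n"
  obtains h where "h \<in> Op L n" "g \<otimes>\<^bsub>Gr L n\<^esub> h = \<one>\<^bsub>Gr L n\<^esub>" "h \<otimes>\<^bsub>Gr L n\<^esub> g = \<one>\<^bsub>Gr L n\<^esub>"
  using assms Gr_carrier[of n] group.inv_closed[OF Gr_group[of n]]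
    group.r_inv[OF Gr_group[of n]] group.l_inv[OF Gr_group[of n]] by metis

section \<open>Classes of pairs under the group action\<close>

lemma und_rel_iff: "((q, xs), (p, ys)) \<in> und_rel L P \<longleftrightarrow> p \<in> Op P (length xs) \<and>
    (\<exists>g\<in>Op L (length xs). q = act P (length xs) p g \<and> ys = lact (proj L (length xs) g) xs)"
  by (auto simp: und_rel_def)

lemma und_rel_pairs: "(z, z') \<in> und_rel L P \<Longrightarrow> z \<in> und_pairs P X \<longleftrightarrow> z' \<in> und_pairs P X"
  by (cases z; cases z')
    (auto simp: und_rel_iff act_Op lact_in_lists_iff proj_permutes)

lemma und_rel_refl: "z \<in> und_pairs P X \<Longrightarrow> (z, z) \<in> und_rel L P"
  by (cases z) (auto simp: und_rel_iff act_one proj_one intro!: bexI[OF _ one_Op])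

lemma und_rel_sym:
  assumes "(z, z') \<in> und_rel L P"
  shows "(z', z) \<in> und_rel L P"
proof -
  obtain q xs p ys where z: "z = (q, xs)" "z' = (p, ys)"
    by fastforce
  let ?n = "length xs"
  obtain g where p: "p \<in> Op P ?n" and g: "g \<in> Op L ?n"
    and eqs: "q = act P ?n p g" "ys = lact (proj L ?n g) xs"
    using assms by (auto simp: z und_rel_iff)
  obtain h where h: "h \<in> Op L ?n" "g \<otimes>\<^bsub>Gr L ?n\<^esub> h = \<one>\<^bsub>Gr L ?n\<^esub>" "h \<otimes>\<^bsub>Gr L ?n\<^esub> g = \<one>\<^bsub>Gr L ?n\<^esub>"
    using ex_inverse[OF g] .
  have "act P ?n q h = p"
    using act_mult[OF p g h(1)] h(2) eqs act_one[OF p] by simp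
  moreover have "lact (proj L ?n h) ys = xs"
    using lact_comp[of "proj L ?n h" xs "proj L ?n g"] proj_mult[OF h(1) g] h g
    by (simp add: eqs proj_permutes proj_one)
  ultimately show ?thesis
    using h(1) act_Op[OF p g] unfolding z und_rel_iff
    by (metis eqs length_lact)
qed

lemma und_rel_trans:
  assumes "(z, z') \<in> und_rel L P" "(z', z'') \<in> und_rel L P"
  shows "(z, z'') \<in> und_rel L P"
proof -
  obtain q xs p ys r ws where z: "z = (q, xs)" "z' = (p, ys)" "z'' = (r, ws)"
    by (metis prod.exhaust)
  let ?n = "length xs"
  obtain g where g: "g \<in> Op L ?n" "q = act P ?n p g" "ys = lact (proj L ?n g) xs"
    using assms(1) by (auto simp: z und_rel_iff)
  then obtain h where r: "r \<in> Op P ?n" and h: "h \<in> Op L ?n" "p = act P ?n r h"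
    "ws = lact (proj L ?n h) ys"
    using assms(2) by (auto simp: z und_rel_iff)
  have "q = act P ?n r (h \<otimes>\<^bsub>Gr L ?n\<^esub> g)"
    using act_mult[OF r h(1) g(1)] g h by simp
  moreover have "ws = lact (proj L ?n (h \<otimes>\<^bsub>Gr L ?n\<^esub> g)) xs"
    using lact_comp[of "proj L ?n h" xs "proj L ?n g"] g h by (simp add: proj_permutes proj_mult)
  ultimately show ?thesis
    using r mult_Op[OF h(1) g(1)] by (auto simp: z und_rel_iff)
qed

lemma und_cls_eq_iff:
  assumes "z \<in> und_pairs P X" "z' \<in> und_pairs P Y"
  shows "und_cls L P z = und_cls L P z' \<longleftrightarrow> (z, z') \<in> und_rel L P"
proof
  assume "und_cls L P z = und_cls L P z'"
  then have "z' \<in> und_cls L P z"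
    using und_rel_refl[OF assms(2)] by (simp add: und_cls_def)
  then show "(z, z') \<in> und_rel L P"
    by (simp add: und_cls_def)
next
  assume "(z, z') \<in> und_rel L P"
  then show "und_cls L P z = und_cls L P z'"
    unfolding und_cls_def using und_rel_trans und_rel_sym by blast
qed

lemma und_cls_act:
  assumes "p \<in> Op P (length xs)" "g \<in> Op L (length xs)"
  shows "und_cls L P (act P (length xs) p g, xs) = und_cls L P (p, lact (proj L (length xs) g) xs)"
  using assms act_Op
  by (subst und_cls_eq_iff[where X = UNIV and Y = UNIV]) (auto simp: und_rel_iff)

lemma und_obj_eq: "und_obj L P X = und_cls L P ` und_pairs P X"
  by (auto simp: und_obj_def und_cls_def und_pairs_def quotient_def)

text \<open>All that is used about the representative chosen in a class of pairs: it lies over the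
  same set \<open>X\<close>, and it has the same class.\<close>

lemma rep_und_cls:
  assumes "z \<in> und_pairs P X"
  shows "rep (und_cls L P z) \<in> und_pairs P X" "und_cls L P (rep (und_cls L P z)) = und_cls L P z"
proof -
  have "z \<in> und_cls L P z"
    using und_rel_refl[OF assms] by (simp add: und_cls_def)
  then have "rep (und_cls L P z) \<in> und_cls L P z"
    unfolding rep_def by (rule someI)
  then have rel: "(z, rep (und_cls L P z)) \<in> und_rel L P"
    by (simp add: und_cls_def)
  then show rep: "rep (und_cls L P z) \<in> und_pairs P X"
    using und_rel_pairs assms by blast
  show "und_cls L P (rep (und_cls L P z)) = und_cls L P z"
    using und_cls_eq_iff[OF assms rep] rel by simp
qed

lemma und_cls_map:
  assumes "(p, xs) \<in> und_pairs P X" "(q, ys) \<in> und_pairs P Y"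
    and "und_cls L P (p, xs) = und_cls L P (q, ys)"
  shows "und_cls L P (p, map f xs) = und_cls L P (q, map f ys)"
proof -
  have "((p, xs), (q, ys)) \<in> und_rel L P"
    using und_cls_eq_iff[OF assms(1,2)] assms(3) by simp
  then have "((p, map f xs), (q, map f ys)) \<in> und_rel L P"
    by (auto simp: und_rel_iff lact_map proj_permutes)
  then show ?thesis
    using assms(1,2)
    by (subst und_cls_eq_iff[where X = UNIV and Y = UNIV]) auto
qed

lemma und_map_cls:
  assumes "(p, xs) \<in> und_pairs P X"
  shows "und_map L P f (und_cls L P (p, xs)) = und_cls L P (p, map f xs)"
proof -
  obtain q ys where rep: "rep (und_cls L P (p, xs)) = (q, ys)"
    by fastforce
  have "und_cls L P (q, map f ys) = und_cls L P (p, map f xs)"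
    using rep_und_cls[OF assms] assms unfolding rep by (intro und_cls_map)
  then show ?thesis
    by (simp add: und_map_def rep)
qed

text \<open>Without compatibility between \<open>mu\<close> and the actions, a product of classes is
  known only on the names \<open>p'\<close>, \<open>zs'\<close> that \<open>rep\<close> happens to
  pick. That other names give the same class is proved separately, in \<open>comp_pair_cong\<close>
  for \<open>P\<close> and in \<open>comp_pair_induced_eq\<close> for the induced operad.\<close>

lemma und_mult_cls:
  assumes "p \<in> Op P (length zs)" "zs \<in> lists (und_pairs P X)"
  obtains p' zs' where "p' \<in> Op P (length zs')" "zs' \<in> lists (und_pairs P X)"
    "und_cls L P (p', map (und_cls L P) zs') = und_cls L P (p, map (und_cls L P) zs)"
    "und_mult L P (und_cls L P (p, map (und_cls L P) zs)) = und_cls L P (comp_pair P p' zs')"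
proof -
  let ?t = "und_cls L P (p, map (und_cls L P) zs)"
  obtain p' ts where rep: "rep ?t = (p', ts)"
    by fastforce
  have "map (und_cls L P) zs \<in> lists (und_cls L P ` und_pairs P X)"
    by (rule map_in_lists[OF assms(2)]) simp
  then have "(p, map (und_cls L P) zs) \<in> und_pairs P (und_cls L P ` und_pairs P X)"
    using assms(1) by simp
  from rep_und_cls[OF this] have ts: "ts \<in> lists (und_cls L P ` und_pairs P X)"
    and p': "p' \<in> Op P (length ts)" and eq: "und_cls L P (p', ts) = ?t"
    by (simp_all add: rep)
  let ?zs = "map rep ts"
  have rep_ts: "rep t \<in> und_pairs P X \<and> und_cls L P (rep t) = t" if "t \<in> set ts" for t
    using ts that rep_und_cls by (fastforce simp: in_lists_conv_set)
  show thesis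
  proof (rule that[of p' ?zs])
    have "map (und_cls L P) ?zs = ts"
      using rep_ts by (simp add: map_idI)
    then show "und_cls L P (p', map (und_cls L P) ?zs) = ?t"
      using eq by (simp only:)
    show "und_mult L P ?t = und_cls L P (comp_pair P p' ?zs)"
      by (simp add: und_mult_def rep comp_pair_def comp_assoc)
  qed (use p' rep_ts in \<open>auto simp: in_lists_conv_set\<close>)
qed

section \<open>Transport along the coding \<open>c\<close>\<close>

context
  fixes c :: "('p \<times> 'u list) set \<Rightarrow> 'u"
  assumes inj: "inj_on c (und_obj L P UNIV)"
begin

lemma inj_on_names: "\<lbrakk>z \<in> und_pairs P UNIV; z' \<in> und_pairs P UNIV\<rbrakk> \<Longrightarrow>
    c (und_cls L P z) = c (und_cls L P z') \<longleftrightarrow> und_cls L P z = und_cls L P z'"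
  using inj by (auto simp: und_obj_eq dest: inj_onD)

lemma und_dec_cls:
  assumes "z \<in> und_pairs P X"
  shows "und_dec c L P (c (und_cls L P z)) = und_cls L P z"
proof -
  have "z \<in> und_pairs P UNIV"
    using assms und_pairs_mono[of X UNIV P] by blast
  then show ?thesis
    unfolding und_dec_def using inj by (intro the_inv_into_f_f) (auto simp: und_obj_eq)
qed

lemma TOb_und_mnd: "TOb (und_mnd c L P) X = (c \<circ> und_cls L P) ` und_pairs P X"
  by (simp add: und_mnd_def und_obj_eq image_comp)

lemma THom_und_mnd:
  assumes "(p, xs) \<in> und_pairs P X"
  shows "THom (und_mnd c L P) X Y f (c (und_cls L P (p, xs))) = c (und_cls L P (p, map f xs))"
  using assms by (auto simp: und_mnd_def und_obj_eq und_dec_cls[OF assms] und_map_cls[OF assms])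

text \<open>The code of the outer class and the codes that are its entries are both undone: the
  former by \<open>und_dec_cls\<close>, the latter because \<open>und_map\<close> applies
  \<open>und_dec\<close> entrywise.\<close>

lemma Mu_und_mnd:
  assumes "p \<in> Op P (length zs)" "zs \<in> lists (und_pairs P X)"
  shows "Mu (und_mnd c L P) X (c (und_cls L P (p, map (c \<circ> und_cls L P) zs))) =
    c (und_mult L P (und_cls L P (p, map (und_cls L P) zs)))"
proof -
  let ?X = "(c \<circ> und_cls L P) ` und_pairs P X"
  have "map (c \<circ> und_cls L P) zs \<in> lists ?X"
    by (rule map_in_lists[OF assms(2)]) simp
  then have pair: "(p, map (c \<circ> und_cls L P) zs) \<in> und_pairs P ?X"
    using assms(1) by simp
  have "map (und_dec c L P) (map (c \<circ> und_cls L P) zs) = map (und_cls L P) zs"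
    using assms(2) und_dec_cls[of _ X] unfolding in_lists_conv_set by simp
  then have "und_map L P (und_dec c L P) (und_cls L P (p, map (c \<circ> und_cls L P) zs)) =
      und_cls L P (p, map (und_cls L P) zs)"
    unfolding und_map_cls[OF pair] by (rule arg_cong)
  then show ?thesis
    using pair und_dec_cls[OF pair]
    by (simp add: und_mnd_def und_obj_eq image_comp del: und_pairs_iff)
qed

lemma Mu_und_mnd_ext: "Mu (und_mnd c L P) X \<in>
    extensional (TOb (und_mnd c L P) (TOb (und_mnd c L P) X))"
  by (simp add: und_mnd_def)

lemma THom_und_mnd_ext: "THom (und_mnd c L P) X Y f \<in> extensional (TOb (und_mnd c L P) X)"
  by (simp add: und_mnd_def)

lemma Eta_und_mnd: "Eta (und_mnd c L P) X = (\<lambda>x\<in>X. c (und_cls L P (ident P, [x])))"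
  by (simp add: und_mnd_def und_unit_def)

end

end

lemma (in action_operad) mu_Op_L:
  "\<lbrakk>g \<in> Op L (length ks); in_Ops L ks gs\<rbrakk> \<Longrightarrow> mu L ks g gs \<in> Op L (sum_list ks)"
  by (rule mu_Op)

sublocale lambda_operad \<subseteq> module: lambda_module L P
  by (intro lambda_module.intro Gr_carrier Gr_group proj_hom act_Op act_one act_mult)

section \<open>Composition of pairs respects the classes\<close>

context lambda_operad
begin

text \<open>Witnesses \<open>g i\<close> for the single entries combine to \<open>beta_op\<close>.
  Its permutation has trivial outer part, so on the concatenation it acts inside each block, exactly
  as the witnesses do.\<close>

lemma comp_pair_inner:
  assumes p: "p \<in> Op P (length zs)" and zs: "zs \<in> lists (und_pairs P UNIV)"
    and rel: "list_all2 (\<lambda>z z'. (z, z') \<in> und_rel L P) zs zs'"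
  shows "(comp_pair P p zs, comp_pair P p zs') \<in> und_rel L P"
proof -
  let ?n = "length zs" and ?ks = "map (length \<circ> snd) zs"
  have len: "length zs' = ?n"
    using rel by (auto dest: list_all2_lengthD)
  have "\<forall>i<?n. \<exists>g. g \<in> Op L (?ks ! i) \<and> fst (zs ! i) = act P (?ks ! i) (fst (zs' ! i)) g \<and>
      snd (zs' ! i) = lact (proj L (?ks ! i) g) (snd (zs ! i))"
  proof (intro allI impI)
    fix i assume i: "i < ?n"
    then have "(zs ! i, zs' ! i) \<in> und_rel L P"
      using rel by (simp add: list_all2_conv_all_nth)
    then show "\<exists>g. g \<in> Op L (?ks ! i) \<and> fst (zs ! i) = act P (?ks ! i) (fst (zs' ! i)) g \<and>
      snd (zs' ! i) = lact (proj L (?ks ! i) g) (snd (zs ! i))"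
      using i by (cases "zs ! i"; cases "zs' ! i") (auto simp: module.und_rel_iff)
  qed
  then obtain g where g: "\<And>i. i < ?n \<Longrightarrow> g i \<in> Op L (?ks ! i)"
    "\<And>i. i < ?n \<Longrightarrow> fst (zs ! i) = act P (?ks ! i) (fst (zs' ! i)) (g i)"
    "\<And>i. i < ?n \<Longrightarrow> snd (zs' ! i) = lact (proj L (?ks ! i) (g i)) (snd (zs ! i))"
    by metis
  define gs where "gs = map g [0..<?n]"
  have gs: "in_Ops L ?ks gs"
    using g(1) by (simp add: gs_def list_all2_conv_all_nth)
  have zs': "zs' \<in> lists (und_pairs P UNIV)"
    using rel zs by (induction rule: list_all2_induct)
      (use module.und_rel_pairs in \<open>simp_all, blast\<close>)
  have ks: "map (length \<circ> snd) zs' = ?ks"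
    using g(3) len by (intro nth_equalityI) auto
  have qs: "in_Ops P ?ks (map fst zs')"
    using in_Ops_und_pairs[OF zs'] unfolding ks .
  have "map (\<lambda>(k, q, g). act P k q g) (zip ?ks (zip (map fst zs') gs)) = map fst zs"
    using g(2) len by (intro nth_equalityI) (auto simp: gs_def)
  then have 1: "mu P ?ks p (map fst zs) = act P (sum_list ?ks) (mu P ?ks p (map fst zs')) (beta_op L ?ks gs)"
    using mu_act_inner[OF _ qs gs, of p] p by simp
  have beta: "beta_op L ?ks gs \<in> Op L (sum_list ?ks)"
    using mu_Op_L[OF _ gs] module.one_Op by (simp add: beta_op_def)
  have proj: "proj L (sum_list ?ks) (beta_op L ?ks gs) = mu Symm ?ks id (map2 (proj L) ?ks gs)"
    using proj_mu[OF _ gs] module.one_Op module.proj_one by (simp add: beta_op_def)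
  have perms: "list_all2 (\<lambda>\<tau> k. \<tau> permutes {..<k}) (map2 (proj L) ?ks gs) ?ks"
    using g(1) module.proj_permutes by (simp add: gs_def list_all2_conv_all_nth)
  have entries: "map2 lact (map2 (proj L) ?ks gs) (map snd zs) = map snd zs'"
    using g(3) len by (intro nth_equalityI) (auto simp: gs_def)
  have 2: "lact (proj L (sum_list ?ks) (beta_op L ?ks gs)) (concat (map snd zs)) =
      concat (map snd zs')"
    using lact_mu_Symm[OF permutes_id perms, of "map snd zs"] unfolding proj entries lact_id
    by (simp only: map_map)
  have "mu P ?ks p (map fst zs') \<in> Op P (sum_list ?ks)"
    using mu_Op[OF _ qs, of p] p by simp
  moreover have "length (concat (map snd zs)) = sum_list ?ks"
    by (simp add: length_concat)
  ultimately show ?thesis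
    using beta 1 2 by (auto simp: comp_pair_def ks module.und_rel_iff)
qed

text \<open>Here \<open>delta_op\<close> is the witness. Its inner permutations are images of unit
  elements, so on the concatenation it moves whole blocks, exactly as \<open>g\<close> moves the
  entries of \<open>zs\<close>.\<close>

lemma comp_pair_outer:
  assumes p: "p \<in> Op P (length zs)" and zs: "zs \<in> lists (und_pairs P UNIV)"
    and g: "g \<in> Op L (length zs)"
  shows "(comp_pair P (act P (length zs) p g) zs, comp_pair P p (lact (proj L (length zs) g) zs))
    \<in> und_rel L P"
proof -
  let ?\<sigma> = "proj L (length zs) g" and ?ks = "map (length \<circ> snd) zs"
  have \<sigma>: "?\<sigma> permutes {..<length zs}"
    using g by (rule module.proj_permutes)
  have qs: "in_Ops P ?ks (map fst zs)"
    using zs by (rule in_Ops_und_pairs)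
  have ones: "in_Ops L ?ks (map (\<lambda>k. \<one>\<^bsub>Gr L k\<^esub>) ?ks)"
    using module.one_Op by (simp add: list_all2_conv_all_nth)
  have 1: "mu P ?ks (act P (length zs) p g) (map fst zs) =
      act P (sum_list ?ks) (mu P (lact ?\<sigma> ?ks) p (lact ?\<sigma> (map fst zs))) (delta_op L ?ks g)"
    using mu_act_outer[of "length zs" ?ks p "map fst zs" g] p g qs by simp
  have delta: "delta_op L ?ks g \<in> Op L (sum_list ?ks)"
    using mu_Op_L[OF _ ones, of g] g by (simp add: delta_op_def)
  have "map2 (proj L) ?ks (map (\<lambda>k. \<one>\<^bsub>Gr L k\<^esub>) ?ks) = map (\<lambda>k. id) ?ks"
    using module.proj_one by (intro nth_equalityI) auto
  then have proj: "proj L (sum_list ?ks) (delta_op L ?ks g) = mu Symm ?ks ?\<sigma> (map (\<lambda>k. id) ?ks)"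
    using proj_mu[OF _ ones, of g] g by (simp add: delta_op_def)
  have entries: "map2 lact (map (\<lambda>k. id) ?ks) (map snd zs) = map snd zs"
    by (intro nth_equalityI) auto
  have perms: "list_all2 (\<lambda>\<tau> k. \<tau> permutes {..<k}) (map (\<lambda>k. id) ?ks) ?ks"
    by (simp add: permutes_id list_all2_conv_all_nth)
  have \<sigma>': "?\<sigma> permutes {..<length ?ks}" and ks: "?ks = map length (map snd zs)"
    using \<sigma> by simp_all
  have 2: "lact (proj L (sum_list ?ks) (delta_op L ?ks g)) (concat (map snd zs)) =
      concat (map snd (lact ?\<sigma> zs))"
    unfolding proj lact_mu_Symm[OF \<sigma>' perms ks] entries
    by (rule arg_cong[OF lact_map[OF \<sigma>]])
  have "lact ?\<sigma> zs \<in> lists (und_pairs P UNIV)"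
    using zs \<sigma> by (simp add: lact_in_lists_iff)
  with p have "comp_pair P p (lact ?\<sigma> zs) \<in> und_pairs P UNIV"
    by (intro comp_pair_in) simp_all
  moreover have "length (concat (map snd (lact ?\<sigma> zs))) = sum_list ?ks"
    unfolding 2[symmetric] by (simp add: length_concat)
  moreover have "length (concat (map snd zs)) = sum_list ?ks"
    by (simp add: length_concat)
  ultimately show ?thesis
    using delta 1 2 lact_map[OF \<sigma>, of fst] lact_map[OF \<sigma>, of "length \<circ> snd"]
    by (auto simp: comp_pair_def module.und_rel_iff)
qed

text \<open>The entries are visible only through \<open>N\<close>, any map that separates
  inequivalent pairs. A witness for the outer equality is absorbed by
  \<open>comp_pair_outer\<close>, and the remaining discrepancy between entries by
  \<open>comp_pair_inner\<close>. The map \<open>N\<close> is the class map of \<open>P\<close> in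
  one application and that of the induced operad, after \<open>ind\<close>, in the other.\<close>

lemma comp_pair_cong:
  assumes p: "p \<in> Op P (length zs)" "zs \<in> lists (und_pairs P UNIV)"
    and p': "p' \<in> Op P (length zs')" "zs' \<in> lists (und_pairs P UNIV)"
    and eq: "und_cls L P (p, map N zs) = und_cls L P (p', map N zs')"
    and N: "\<And>z z'. \<lbrakk>z \<in> und_pairs P UNIV; z' \<in> und_pairs P UNIV; N z = N z'\<rbrakk> \<Longrightarrow>
      und_cls L P z = und_cls L P z'"
  shows "und_cls L P (comp_pair P p zs) = und_cls L P (comp_pair P p' zs')"
proof -
  have "((p, map N zs), (p', map N zs')) \<in> und_rel L P"
    using p p' eq by (subst module.und_cls_eq_iff[symmetric, where X = UNIV and Y = UNIV]) auto
  then obtain g where g: "g \<in> Op L (length zs)" "p = act P (length zs) p' g"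
    "map N zs' = lact (proj L (length zs) g) (map N zs)"
    by (auto simp: module.und_rel_iff)
  let ?\<sigma> = "proj L (length zs) g"
  have \<sigma>: "?\<sigma> permutes {..<length zs}"
    using g(1) by (rule module.proj_permutes)
  \<comment> \<open>After permuting by \<open>g\<close> the entries match only under
    \<open>N\<close>; hence the inner step that follows.\<close>
  have N_eq: "map N (lact ?\<sigma> zs) = map N zs'"
    using g(3) lact_map[OF \<sigma>, of N] by simp
  then have len: "length zs' = length zs"
    by (metis length_lact length_map)
  have \<sigma>zs: "lact ?\<sigma> zs \<in> lists (und_pairs P UNIV)"
    using p(2) \<sigma> by (simp add: lact_in_lists_iff)
  have "list_all2 (\<lambda>z z'. (z, z') \<in> und_rel L P) (lact ?\<sigma> zs) zs'"
    unfolding list_all2_conv_all_nth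
  proof (intro conjI allI impI)
    fix i assume i: "i < length (lact ?\<sigma> zs)"
    then have "lact ?\<sigma> zs ! i \<in> und_pairs P UNIV" "zs' ! i \<in> und_pairs P UNIV"
      using \<sigma>zs p'(2) len by (auto simp: in_lists_conv_set)
    moreover have "N (lact ?\<sigma> zs ! i) = N (zs' ! i)"
      using arg_cong[OF N_eq, of "\<lambda>xs. xs ! i"] i len by simp
    ultimately show "(lact ?\<sigma> zs ! i, zs' ! i) \<in> und_rel L P"
      using N module.und_cls_eq_iff by blast
  qed (simp add: len)
  then have "(comp_pair P p' (lact ?\<sigma> zs), comp_pair P p' zs') \<in> und_rel L P"
    using p' len \<sigma>zs by (intro comp_pair_inner) simp_all
  moreover have "(comp_pair P p zs, comp_pair P p' (lact ?\<sigma> zs)) \<in> und_rel L P"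
    unfolding g(2) using p(2) p' len g(1) by (intro comp_pair_outer) simp_all
  ultimately have "(comp_pair P p zs, comp_pair P p' zs') \<in> und_rel L P"
    using module.und_rel_trans by blast
  then show ?thesis
    using module.und_cls_eq_iff comp_pair_in[OF p] comp_pair_in[OF p'] by blast
qed

lemma presented_und_mnd:
  assumes "inj_on c (und_obj L P UNIV)"
  shows "presented_monad P (c \<circ> und_cls L P) (und_mnd c L P)"
proof (unfold_locales, goal_cases)
  case (6 p zs X)
  obtain p' zs' where p': "p' \<in> Op P (length zs')" "zs' \<in> lists (und_pairs P X)"
    and eq: "und_cls L P (p', map (und_cls L P) zs') = und_cls L P (p, map (und_cls L P) zs)"
      "und_mult L P (und_cls L P (p, map (und_cls L P) zs)) = und_cls L P (comp_pair P p' zs')"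
    using 6 by (rule module.und_mult_cls)
  have "lists (und_pairs P X) \<subseteq> lists (und_pairs P UNIV)"
    by (intro lists_mono und_pairs_mono) simp
  then have "und_cls L P (comp_pair P p' zs') = und_cls L P (comp_pair P p zs)"
    using 6 p' eq(1) by (intro comp_pair_cong[where N = "und_cls L P"]) auto
  then show ?case
    using module.Mu_und_mnd[OF assms 6] eq(2) by simp
next
  case (2 X Y f)
  show ?case
    using module.THom_und_mnd_ext[OF assms] .
next
  case (5 X)
  show ?case
    using module.Mu_und_mnd_ext[OF assms] .
qed (simp_all add: module.TOb_und_mnd[OF assms] module.THom_und_mnd[OF assms]
    module.Eta_und_mnd[OF assms])

end

section \<open>The induced operad\<close>

definition ind_pair :: "'l action_operad_data \<Rightarrow> ('p, 'l) lambda_operad_data \<Rightarrow> 'p \<times> 'x list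
    \<Rightarrow> ('p \<times> (nat \<Rightarrow> nat)) set \<times> 'x list" where
  "ind_pair L P = (\<lambda>(p, xs). (ind_cls L P (length xs) (p, id), xs))"

text \<open>As a pair the value depends on the representative that \<open>rep\<close> picks; for
  pairs over the induced operad its class depends only on the class of the argument, by
  \<open>unind_pair\<close> and \<open>und_cls_ind_eq_iff\<close> below.\<close>

definition unind_pair :: "('p \<times> (nat \<Rightarrow> nat)) set \<times> 'x list \<Rightarrow> 'p \<times> 'x list" where
  "unind_pair = (\<lambda>(C, xs). (fst (rep C), lact (snd (rep C)) xs))"

lemma proj_Symm [simp]: "proj Symm n \<sigma> = \<sigma>"
  by (simp add: Symm_def)

section \<open>The classes that form the induced operad, and the symmetric action on them\<close>

context lambda_operad
begin

abbreviation "I \<equiv> induced L P"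

lemma ind_rel_iff: "((q, \<sigma>), (p, \<tau>)) \<in> ind_rel L P n \<longleftrightarrow> p \<in> Op P n \<and> \<sigma> permutes {..<n} \<and>
    (\<exists>g\<in>Op L n. q = act P n p g \<and> \<tau> = proj L n g \<circ> \<sigma>)"
  by (auto simp: ind_rel_def)

lemma ind_rel_refl:
  assumes "p \<in> Op P n" "\<tau> permutes {..<n}"
  shows "((p, \<tau>), (p, \<tau>)) \<in> ind_rel L P n"
  using assms by (auto simp: ind_rel_iff act_one module.proj_one intro!: bexI[OF _ module.one_Op])

lemma ind_rel_sym:
  assumes "(z, z') \<in> ind_rel L P n"
  shows "(z', z) \<in> ind_rel L P n"
proof -
  obtain q \<sigma> p \<tau> where z: "z = (q, \<sigma>)" "z' = (p, \<tau>)"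
    by fastforce
  obtain g where p: "p \<in> Op P n" and g: "g \<in> Op L n" and \<sigma>: "\<sigma> permutes {..<n}"
    and eqs: "q = act P n p g" "\<tau> = proj L n g \<circ> \<sigma>"
    using assms by (auto simp: z ind_rel_iff)
  obtain h where h: "h \<in> Op L n" "g \<otimes>\<^bsub>Gr L n\<^esub> h = \<one>\<^bsub>Gr L n\<^esub>" "h \<otimes>\<^bsub>Gr L n\<^esub> g = \<one>\<^bsub>Gr L n\<^esub>"
    using module.ex_inverse[OF g] .
  have "act P n q h = p"
    using act_mult[OF p g h(1)] h(2) eqs act_one[OF p] by simp
  moreover have "proj L n h \<circ> \<tau> = \<sigma>"
    using module.proj_mult[OF h(1) g] h by (simp add: eqs comp_assoc[symmetric] module.proj_one)
  moreover have "\<tau> permutes {..<n}"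
    using eqs(2) permutes_compose[OF \<sigma> module.proj_permutes[OF g]] by simp
  ultimately show ?thesis
    using h(1) act_Op[OF p g] unfolding z ind_rel_iff by (metis eqs(1))
qed

lemma ind_rel_trans:
  assumes "(z, z') \<in> ind_rel L P n" "(z', z'') \<in> ind_rel L P n"
  shows "(z, z'') \<in> ind_rel L P n"
proof -
  obtain q \<rho> p \<sigma> r \<tau> where z: "z = (q, \<rho>)" "z' = (p, \<sigma>)" "z'' = (r, \<tau>)"
    by (metis prod.exhaust)
  obtain g where g: "g \<in> Op L n" "q = act P n p g" "\<sigma> = proj L n g \<circ> \<rho>" and \<rho>: "\<rho> permutes {..<n}"
    using assms(1) by (auto simp: z ind_rel_iff)
  obtain h where r: "r \<in> Op P n" and h: "h \<in> Op L n" "p = act P n r h" "\<tau> = proj L n h \<circ> \<sigma>"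
    using assms(2) by (auto simp: z ind_rel_iff)
  have "q = act P n r (h \<otimes>\<^bsub>Gr L n\<^esub> g)"
    using act_mult[OF r h(1) g(1)] g h by simp
  moreover have "\<tau> = proj L n (h \<otimes>\<^bsub>Gr L n\<^esub> g) \<circ> \<rho>"
    using g h by (simp add: module.proj_mult comp_assoc)
  ultimately show ?thesis
    using r \<rho> module.mult_Op[OF h(1) g(1)] by (auto simp: z ind_rel_iff)
qed

lemma ind_cls_eq_iff:
  assumes "q \<in> Op P n" "\<sigma> permutes {..<n}" "p \<in> Op P n" "\<tau> permutes {..<n}"
  shows "ind_cls L P n (q, \<sigma>) = ind_cls L P n (p, \<tau>) \<longleftrightarrow> ((q, \<sigma>), (p, \<tau>)) \<in> ind_rel L P n"
proof
  assume "ind_cls L P n (q, \<sigma>) = ind_cls L P n (p, \<tau>)"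
  then have "(p, \<tau>) \<in> ind_cls L P n (q, \<sigma>)"
    using ind_rel_refl assms by (simp add: ind_cls_def)
  then show "((q, \<sigma>), (p, \<tau>)) \<in> ind_rel L P n"
    by (simp add: ind_cls_def)
next
  assume "((q, \<sigma>), (p, \<tau>)) \<in> ind_rel L P n"
  then show "ind_cls L P n (q, \<sigma>) = ind_cls L P n (p, \<tau>)"
    unfolding ind_cls_def using ind_rel_trans ind_rel_sym by blast
qed

lemma ind_cls_Op: "\<lbrakk>p \<in> Op P n; \<tau> permutes {..<n}\<rbrakk> \<Longrightarrow> ind_cls L P n (p, \<tau>) \<in> Op I n"
  by (auto simp: induced_def ind_cls_def intro!: quotientI)

lemma rep_induced:
  assumes "C \<in> Op I n" "rep C = (p, \<tau>)"
  shows "p \<in> Op P n" "\<tau> permutes {..<n}" "C = ind_cls L P n (p, \<tau>)"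
proof -
  obtain q \<sigma> where q: "q \<in> Op P n" "\<sigma> permutes {..<n}" and C: "C = ind_cls L P n (q, \<sigma>)"
    using assms(1) by (auto simp: induced_def ind_cls_def elim!: quotientE)
  have "(q, \<sigma>) \<in> C"
    using ind_rel_refl[OF q] by (simp add: C ind_cls_def)
  then have "rep C \<in> C"
    unfolding rep_def by (rule someI)
  then have rel: "((q, \<sigma>), (p, \<tau>)) \<in> ind_rel L P n"
    unfolding assms(2) by (simp add: C ind_cls_def)
  then show "p \<in> Op P n" "\<tau> permutes {..<n}"
    by (auto simp: ind_rel_iff intro!: permutes_compose module.proj_permutes)
  then show "C = ind_cls L P n (p, \<tau>)"
    using rel ind_cls_eq_iff q C by simp
qed

text \<open>Changing the representative multiplies the permutation by \<open>proj L n g\<close> on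
  the left, which commutes with the multiplication by \<open>\<sigma>\<close> on the right.\<close>

lemma act_induced:
  assumes p: "p \<in> Op P n" "\<tau> permutes {..<n}" and \<sigma>: "\<sigma> permutes {..<n}"
  shows "act I n (ind_cls L P n (p, \<tau>)) \<sigma> = ind_cls L P n (p, \<tau> \<circ> \<sigma>)"
proof -
  obtain q \<rho> where rep: "rep (ind_cls L P n (p, \<tau>)) = (q, \<rho>)"
    by fastforce
  note q = rep_induced[OF ind_cls_Op[OF p] rep]
  have "((p, \<tau>), (q, \<rho>)) \<in> ind_rel L P n"
    using ind_cls_eq_iff[OF p q(1,2)] q(3) by simp
  then have "((p, \<tau> \<circ> \<sigma>), (q, \<rho> \<circ> \<sigma>)) \<in> ind_rel L P n"
    using permutes_compose[OF \<sigma>] by (auto simp: ind_rel_iff comp_assoc)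
  then have "ind_cls L P n (p, \<tau> \<circ> \<sigma>) = ind_cls L P n (q, \<rho> \<circ> \<sigma>)"
    using ind_cls_eq_iff p q(1,2) permutes_compose[OF \<sigma>] by simp
  then show ?thesis
    by (simp add: induced_def rep Symm_def)
qed

end

sublocale lambda_operad \<subseteq> ind: lambda_module Symm "induced L P"
proof (rule lambda_module.intro, goal_cases)
  case (1 n)
  show ?case
    by (simp add: Symm_def)
next
  case (2 n)
  show ?case
    by (rule group_Symm)
next
  case (3 n)
  show ?case
    by (simp add: Symm_def hom_def)
next
  case (4 C n \<sigma>)
  obtain p \<tau> where rep: "rep C = (p, \<tau>)"
    by fastforce
  show ?case
    using rep_induced[OF 4(1) rep] 4(2) by (simp add: act_induced ind_cls_Op permutes_compose)
next
  case (5 C n)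
  obtain p \<tau> where rep: "rep C = (p, \<tau>)"
    by fastforce
  have "act I n (ind_cls L P n (p, \<tau>)) id = ind_cls L P n (p, \<tau>)"
    using rep_induced[OF 5 rep] by (simp add: act_induced permutes_id)
  then show ?case
    using rep_induced(3)[OF 5 rep] by (simp add: Symm_def)
next
  case (6 C n \<sigma> \<rho>)
  obtain p \<tau> where rep: "rep C = (p, \<tau>)"
    by fastforce
  have "act I n (ind_cls L P n (p, \<tau>)) (\<sigma> \<circ> \<rho>) =
      act I n (act I n (ind_cls L P n (p, \<tau>)) \<sigma>) \<rho>"
    using rep_induced(1,2)[OF 6(1) rep] 6(2,3)
    by (simp add: act_induced permutes_compose comp_assoc)
  then show ?case
    using rep_induced(3)[OF 6(1) rep] by (simp add: Symm_def)
qed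

section \<open>Pairs over \<open>P\<close> as names for the monad of the induced operad\<close>

context lambda_operad
begin

abbreviation "ind \<equiv> ind_pair L P"

lemma ind_in_pairs: "z \<in> und_pairs P X \<Longrightarrow> ind z \<in> und_pairs I X"
  by (cases z) (simp add: ind_pair_def ind_cls_Op permutes_id)

text \<open>Since \<open>[p, \<tau>] = [p, id] \<cdot> \<tau>\<close>, the symmetric action lets
  \<open>\<tau>\<close> pass from the operation to the list.\<close>

lemma und_cls_ind_cls:
  assumes "p \<in> Op P (length xs)" "\<tau> permutes {..<length xs}"
  shows "und_cls Symm I (ind_cls L P (length xs) (p, \<tau>), xs) = und_cls Symm I (ind (p, lact \<tau> xs))"
proof -
  have "act I (length xs) (ind_cls L P (length xs) (p, id)) \<tau> = ind_cls L P (length xs) (p, \<tau>)"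
    using act_induced[OF assms(1) permutes_id assms(2)] by simp
  then show ?thesis
    using ind.und_cls_act[of "ind_cls L P (length xs) (p, id)" xs \<tau>] assms
    by (simp add: ind_pair_def ind_cls_Op permutes_id)
qed

text \<open>An equality on the left means that some \<open>\<tau>\<close> takes \<open>xs\<close> to
  \<open>ys\<close> and \<open>[q, id] = [p, \<tau>]\<close>. The latter holds exactly when
  \<open>\<tau>\<close> is the permutation of some \<open>g\<close> with
  \<open>q = p \<cdot> g\<close>, and such a \<open>g\<close> is a witness over
  \<open>L\<close>.\<close>

lemma und_cls_ind_eq_iff:
  assumes z: "z \<in> und_pairs P X" "z' \<in> und_pairs P X"
  shows "und_cls Symm I (ind z) = und_cls Symm I (ind z') \<longleftrightarrow> und_cls L P z = und_cls L P z'"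
proof -
  obtain q xs p ys where zz: "z = (q, xs)" "z' = (p, ys)"
    by fastforce
  let ?n = "length xs"
  have "und_cls Symm I (ind z) = und_cls Symm I (ind z') \<longleftrightarrow> (ind z, ind z') \<in> und_rel Symm I"
    by (rule ind.und_cls_eq_iff[OF ind_in_pairs[OF z(1)] ind_in_pairs[OF z(2)]])
  also have "\<dots> \<longleftrightarrow> (\<exists>\<tau>. \<tau> permutes {..<?n} \<and> ys = lact \<tau> xs \<and>
      ind_cls L P ?n (q, id) = ind_cls L P ?n (p, \<tau>))"
    using z by (auto simp: zz ind_pair_def ind.und_rel_iff act_induced permutes_id ind_cls_Op Bex_def)
  also have "\<dots> \<longleftrightarrow> (z, z') \<in> und_rel L P"
  proof (cases "length ys = ?n")
    case True
    then have "ind_cls L P ?n (q, id) = ind_cls L P ?n (p, \<tau>) \<longleftrightarrow>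
        (\<exists>g\<in>Op L ?n. q = act P ?n p g \<and> \<tau> = proj L ?n g)" if "\<tau> permutes {..<?n}" for \<tau>
      using that z by (auto simp: zz ind_cls_eq_iff permutes_id ind_rel_iff)
    moreover have "p \<in> Op P ?n"
      using z True by (simp add: zz)
    ultimately show ?thesis
      using module.proj_permutes unfolding zz module.und_rel_iff by metis
  qed (auto simp: zz module.und_rel_iff)
  also have "\<dots> \<longleftrightarrow> und_cls L P z = und_cls L P z'"
    by (rule module.und_cls_eq_iff[OF z, symmetric])
  finally show ?thesis .
qed

lemma unind_pair:
  assumes "v \<in> und_pairs I X"
  shows "unind_pair v \<in> und_pairs P X" "und_cls Symm I (ind (unind_pair v)) = und_cls Symm I v"
proof -
  obtain C xs p \<tau> where v: "v = (C, xs)" and rep: "rep C = (p, \<tau>)"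
    by (metis prod.exhaust)
  have C: "C \<in> Op I (length xs)" and xs: "xs \<in> lists X"
    using assms by (auto simp: v)
  note C = rep_induced[OF C rep]
  show "unind_pair v \<in> und_pairs P X"
    using C(1,2) xs by (simp add: v unind_pair_def rep lact_in_lists_iff)
  show "und_cls Symm I (ind (unind_pair v)) = und_cls Symm I v"
    using und_cls_ind_cls[OF C(1,2)]
    by (simp only: v unind_pair_def rep prod.case fst_conv snd_conv C(3)[symmetric])
qed

text \<open>The composite over the induced operad carries the permutation \<open>mu Symm\<close> of
  the chosen representatives. Passing it to the list by \<open>und_cls_ind_cls\<close> and
  evaluating it by \<open>lact_mu_Symm\<close> leaves a composite in \<open>P\<close>.\<close>

lemma comp_pair_induced:
  assumes C: "C \<in> Op I (length vs)" and vs: "vs \<in> lists (und_pairs I X)" and rep: "rep C = (p, \<tau>)"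
  shows "comp_pair I C vs \<in> und_pairs I X"
    "und_cls Symm I (comp_pair I C vs) =
      und_cls Symm I (ind (comp_pair P p (lact \<tau> (map unind_pair vs))))"
proof -
  note C = rep_induced[OF C rep]
  let ?ks = "map (length \<circ> snd) vs" and ?ws = "map unind_pair vs"
  let ?qs = "map (fst \<circ> rep) (map fst vs)" and ?\<tau>s = "map (snd \<circ> rep) (map fst vs)"
  have vs_rep: "fst (rep (fst v)) \<in> Op P (length (snd v)) \<and>
      snd (rep (fst v)) permutes {..<length (snd v)}" if "v \<in> set vs" for v
  proof -
    have "v \<in> und_pairs I X"
      using that vs by (simp add: in_lists_conv_set)
    then show ?thesis
      using rep_induced(1,2)[of "fst v" "length (snd v)", OF _ prod.collapse[symmetric]]
      by (simp add: und_pairs_def case_prod_unfold)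
  qed
  have \<tau>s: "list_all2 (\<lambda>\<tau> k. \<tau> permutes {..<k}) ?\<tau>s ?ks"
    using vs_rep by (simp add: list_all2_conv_all_nth)
  have \<tau>: "\<tau> permutes {..<length vs}"
    by (rule C(2))
  have ws: "?ws \<in> lists (und_pairs P X)"
    using vs unind_pair(1) by (rule map_in_lists)
  then have \<tau>ws: "lact \<tau> ?ws \<in> lists (und_pairs P X)"
    using \<tau> by (simp add: lact_in_lists_iff)
  have fsts: "lact \<tau> ?qs = map fst (lact \<tau> ?ws)"
    using \<tau> by (simp add: lact_map unind_pair_def case_prod_unfold comp_def)
  have lengths: "lact \<tau> ?ks = map (length \<circ> snd) (lact \<tau> ?ws)"
    using \<tau> by (simp add: lact_map unind_pair_def case_prod_unfold comp_def)
  have "map2 lact ?\<tau>s (map snd vs) = map snd ?ws"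
    by (intro nth_equalityI) (auto simp: unind_pair_def case_prod_unfold)
  moreover have "lact \<tau> (map snd ?ws) = map snd (lact \<tau> ?ws)"
    using \<tau> by (intro lact_map) simp
  moreover have \<tau>': "\<tau> permutes {..<length ?ks}" and ks: "?ks = map length (map snd vs)"
    using \<tau> by simp_all
  ultimately have snds: "lact (mu Symm ?ks \<tau> ?\<tau>s) (concat (map snd vs)) =
      concat (map snd (lact \<tau> ?ws))"
    using lact_mu_Symm[OF \<tau>' \<tau>s ks] by (simp only:)
  have len: "length (concat (map snd vs)) = sum_list ?ks"
    by (simp add: length_concat)
  \<comment> \<open>The induced multiplication and \<open>unind_pair\<close> choose the same
    representatives, so this holds on the nose, with no appeal to well-definedness.\<close>
  have mu: "mu I ?ks C (map fst vs) =
      ind_cls L P (sum_list ?ks) (fst (comp_pair P p (lact \<tau> ?ws)), mu Symm ?ks \<tau> ?\<tau>s)"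
    by (simp only: induced_def operad_data.simps rep prod.case fsts lengths comp_pair_def fst_conv)
  have "comp_pair P p (lact \<tau> ?ws) \<in> und_pairs P X"
    using C(1) \<tau>ws by (intro comp_pair_in) simp_all
  moreover have "snd (comp_pair P p (lact \<tau> ?ws)) = lact (mu Symm ?ks \<tau> ?\<tau>s) (concat (map snd vs))"
    by (simp only: comp_pair_def snds snd_conv)
  ultimately have pair: "comp_pair P p (lact \<tau> ?ws) =
      (fst (comp_pair P p (lact \<tau> ?ws)), lact (mu Symm ?ks \<tau> ?\<tau>s) (concat (map snd vs)))"
    and Op: "fst (comp_pair P p (lact \<tau> ?ws)) \<in> Op P (length (concat (map snd vs)))"
    by (auto simp: prod_eq_iff und_pairs_def case_prod_unfold simp del: length_concat)
  have perm: "mu Symm ?ks \<tau> ?\<tau>s permutes {..<length (concat (map snd vs))}"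
    unfolding len by (rule mu_Symm_permutes[OF \<tau>' \<tau>s])
  have "concat (map snd vs) \<in> lists X"
    using vs by (fastforce simp: in_lists_conv_set)
  then show "comp_pair I C vs \<in> und_pairs I X"
    using ind_cls_Op[OF Op perm] unfolding comp_pair_def[of I] mu len by (simp add: len)
  show "und_cls Symm I (comp_pair I C vs) = und_cls Symm I (ind (comp_pair P p (lact \<tau> ?ws)))"
    using und_cls_ind_cls[OF Op perm] unfolding comp_pair_def[of I] mu len pair[symmetric] .
qed

text \<open>Plays the role of \<open>comp_pair_cong\<close> for the induced operad and is reduced to
  it: \<open>unind_pair\<close> brings both sides to composites in \<open>P\<close>, and
  \<open>und_cls_ind_eq_iff\<close> translates equalities of classes back and forth.\<close>

lemma comp_pair_induced_eq:
  assumes C: "C \<in> Op I (length vs)" "vs \<in> lists (und_pairs I X)"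
    and p: "p \<in> Op P (length zs)" "zs \<in> lists (und_pairs P X)"
    and eq: "und_cls Symm I (C, map (und_cls Symm I) vs) =
      und_cls Symm I (ind (p, map (und_cls Symm I \<circ> ind) zs))"
  shows "und_cls Symm I (comp_pair I C vs) = und_cls Symm I (ind (comp_pair P p zs))"
proof -
  obtain p' \<tau> where rep: "rep C = (p', \<tau>)"
    by fastforce
  note p' = rep_induced[OF C(1) rep]
  let ?K = "und_cls Symm I \<circ> ind" and ?ws = "lact \<tau> (map unind_pair vs)"
  have UNIV: "lists (und_pairs P X) \<subseteq> lists (und_pairs P UNIV)"
    by (intro lists_mono und_pairs_mono) simp
  have "map unind_pair vs \<in> lists (und_pairs P X)"
    using C(2) unind_pair(1) by (rule map_in_lists)
  then have ws: "?ws \<in> lists (und_pairs P X)"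
    using p'(2) by (simp add: lact_in_lists_iff)
  have "map (und_cls Symm I) vs = map ?K (map unind_pair vs)"
    using C(2) unind_pair(2)[of _ X] unfolding in_lists_conv_set by simp
  then have "und_cls Symm I (C, map (und_cls Symm I) vs) =
      und_cls Symm I (ind_cls L P (length vs) (p', \<tau>), map ?K (map unind_pair vs))"
    using p'(3) by (simp only:)
  also have "\<dots> = und_cls Symm I (ind (p', lact \<tau> (map ?K (map unind_pair vs))))"
    using und_cls_ind_cls[of p' "map ?K (map unind_pair vs)" \<tau>] p'(1,2) by (simp only: length_map)
  also have "lact \<tau> (map ?K (map unind_pair vs)) = map ?K ?ws"
    using p'(2) by (intro lact_map) simp
  finally have "und_cls Symm I (ind (p', map ?K ?ws)) = und_cls Symm I (ind (p, map ?K zs))"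
    using eq by (simp only:)
  \<comment> \<open>Injectivity is used here one level up, for pairs whose entries are themselves
    classes over the induced operad.\<close>
  then have "und_cls L P (p', map ?K ?ws) = und_cls L P (p, map ?K zs)"
    using p'(1) p(1) by (subst (asm) und_cls_ind_eq_iff[where X = UNIV]) simp_all
  then have "und_cls L P (comp_pair P p' ?ws) = und_cls L P (comp_pair P p zs)"
    using p p'(1) ws UNIV und_cls_ind_eq_iff[where X = UNIV]
    by (intro comp_pair_cong[where N = ?K]) (simp_all only: o_apply length_lact length_map, blast+)
  moreover have "comp_pair P p' ?ws \<in> und_pairs P X"
    using p'(1) ws by (intro comp_pair_in) simp_all
  ultimately show ?thesis
    using comp_pair_induced(2)[OF C rep] und_cls_ind_eq_iff[OF _ comp_pair_in[OF p]] by simp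
qed

lemma und_cls_induced_image:
  "und_cls Symm I ` und_pairs I X = (und_cls Symm I \<circ> ind) ` und_pairs P X"
proof (intro equalityI subsetI)
  fix t assume "t \<in> und_cls Symm I ` und_pairs I X"
  then obtain v where "v \<in> und_pairs I X" "t = und_cls Symm I v"
    by blast
  then show "t \<in> (und_cls Symm I \<circ> ind) ` und_pairs P X"
    using unind_pair[of v X] by (intro image_eqI[of _ _ "unind_pair v"]) (simp_all del: und_pairs_iff)
qed (use ind_in_pairs in \<open>auto simp del: und_pairs_iff\<close>)

lemma ident_induced: "(ident I, [x]) = ind (ident P, [x])"
  by (simp add: induced_def ind_pair_def Symm_def)

lemma presented_und_mnd_induced:
  assumes inj: "inj_on d (und_obj Symm I UNIV)"
  shows "presented_monad P (d \<circ> und_cls Symm I \<circ> ind) (und_mnd d Symm I)"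
proof (unfold_locales, goal_cases)
  case (1 X)
  show ?case
    using arg_cong[OF und_cls_induced_image, of "image d" X]
    by (simp add: ind.TOb_und_mnd[OF inj] image_comp comp_assoc)
next
  case (2 X Y f)
  show ?case
    using ind.THom_und_mnd_ext[OF inj] .
next
  case (3 f X Y p xs)
  then show ?case
    using ind_in_pairs[of "(p, xs)" X] ind.THom_und_mnd[OF inj, of "fst (ind (p, xs))" xs X Y f]
    by (simp add: ind_pair_def)
next
  case (4 X)
  show ?case
    by (simp add: ind.Eta_und_mnd[OF inj] ident_induced)
next
  case (5 X)
  show ?case
    using ind.Mu_und_mnd_ext[OF inj] .
next
  case (6 p zs X)
  \<comment> \<open>The first component of \<open>ind (p, xs)\<close> depends on \<open>xs\<close>
    only through its length, so \<open>?C\<close> serves both for \<open>zs\<close> and for the list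
    of names of its entries.\<close>
  let ?C = "ind_cls L P (length zs) (p, id)"
  have C: "?C \<in> Op I (length (map ind zs))"
    using 6(1) by (simp add: ind_cls_Op permutes_id)
  have ind_zs: "map ind zs \<in> lists (und_pairs I X)"
    using 6(2) ind_in_pairs by (rule map_in_lists)
  obtain C' vs where C': "C' \<in> Op I (length vs)" "vs \<in> lists (und_pairs I X)"
    and eq: "und_cls Symm I (C', map (und_cls Symm I) vs) =
        und_cls Symm I (?C, map (und_cls Symm I) (map ind zs))"
      "und_mult Symm I (und_cls Symm I (?C, map (und_cls Symm I) (map ind zs))) =
        und_cls Symm I (comp_pair I C' vs)"
    using C ind_zs by (rule ind.und_mult_cls)
  have "und_cls Symm I (comp_pair I C' vs) = und_cls Symm I (ind (comp_pair P p zs))"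
    using eq(1) by (intro comp_pair_induced_eq[OF C' 6]) (simp add: ind_pair_def)
  then show ?case
    using ind.Mu_und_mnd[OF inj C ind_zs] eq(2) by (simp add: ind_pair_def comp_assoc)
qed

lemma presented_monads_und_mnd:
  fixes c :: "('p \<times> 'u list) set \<Rightarrow> 'u" and d :: "(('p \<times> (nat \<Rightarrow> nat)) set \<times> 'u list) set \<Rightarrow> 'u"
  assumes c: "inj_on c (und_obj L P UNIV)" and d: "inj_on d (und_obj Symm I UNIV)"
  shows "presented_monads P (c \<circ> und_cls L P) (d \<circ> und_cls Symm I \<circ> ind)
    (und_mnd c L P) (und_mnd d Symm I)"
proof (intro presented_monads.intro presented_monads_axioms.intro
    presented_und_mnd[OF c] presented_und_mnd_induced[OF d])
  fix z z' :: "'p \<times> 'u list"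
  assume z: "z \<in> und_pairs P UNIV" "z' \<in> und_pairs P UNIV"
  show "(c \<circ> und_cls L P) z = (c \<circ> und_cls L P) z' \<longleftrightarrow>
      (d \<circ> und_cls Symm I \<circ> ind) z = (d \<circ> und_cls Symm I \<circ> ind) z'"
    using module.inj_on_names[OF c z] und_cls_ind_eq_iff[OF z]
      ind.inj_on_names[OF d ind_in_pairs[OF z(1)] ind_in_pairs[OF z(2)]] by simp
qed

end

section \<open>Algebras of operads\<close>

text \<open>Trades the parallel lists \<open>qs\<close> and \<open>xss\<close> for one list of
  pairs, so that the facts about \<open>comp_pair\<close> apply to operad algebras.\<close>

lemma is_operad_alg_iff:
  "is_operad_alg L P A \<theta> \<longleftrightarrow> \<theta> \<in> und_pairs P A \<rightarrow>\<^sub>E A \<and> (\<forall>x\<in>A. \<theta> (ident P, [x]) = x) \<and>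
     (\<forall>p zs. p \<in> Op P (length zs) \<longrightarrow> zs \<in> lists (und_pairs P A) \<longrightarrow>
       \<theta> (comp_pair P p zs) = \<theta> (p, map \<theta> zs)) \<and>
     (\<forall>p g xs. xs \<in> lists A \<longrightarrow> p \<in> Op P (length xs) \<longrightarrow> g \<in> Op L (length xs) \<longrightarrow>
       \<theta> (act P (length xs) p g, xs) = \<theta> (p, lact (proj L (length xs) g) xs))"
proof -
  have "(\<forall>p qs xss. xss \<in> lists (lists A) \<and> p \<in> Op P (length xss) \<and> in_Ops P (map length xss) qs
        \<longrightarrow> \<theta> (mu P (map length xss) p qs, concat xss) = \<theta> (p, map \<theta> (zip qs xss))) \<longleftrightarrow>
     (\<forall>p zs. p \<in> Op P (length zs) \<longrightarrow> zs \<in> lists (und_pairs P A) \<longrightarrow>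
       \<theta> (comp_pair P p zs) = \<theta> (p, map \<theta> zs))" (is "?l \<longleftrightarrow> ?r")
  proof (intro iffI allI impI)
    fix p zs
    assume ?l and p: "p \<in> Op P (length zs)" and zs: "zs \<in> lists (und_pairs P A)"
    have "map snd zs \<in> lists (lists A)"
      by (rule map_in_lists[OF zs]) (auto simp: und_pairs_def)
    moreover have "in_Ops P (map length (map snd zs)) (map fst zs)"
      using in_Ops_und_pairs[OF zs] by (simp add: list.rel_map)
    ultimately have "\<theta> (mu P (map length (map snd zs)) p (map fst zs), concat (map snd zs)) =
        \<theta> (p, map \<theta> (zip (map fst zs) (map snd zs)))"
      using \<open>?l\<close> p by (metis length_map)
    then show "\<theta> (comp_pair P p zs) = \<theta> (p, map \<theta> zs)"
      by (simp add: comp_pair_def zip_map_fst_snd)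
  next
    fix p qs xss
    assume r: ?r and *: "xss \<in> lists (lists A) \<and> p \<in> Op P (length xss) \<and> in_Ops P (map length xss) qs"
    then have len: "length qs = length xss"
      by (auto dest: list_all2_lengthD)
    have "zip qs xss \<in> lists (und_pairs P A)"
    proof (intro in_listsI ballI)
      fix z assume "z \<in> set (zip qs xss)"
      then obtain i where i: "i < length xss" "z = (qs ! i, xss ! i)"
        by (auto simp: in_set_zip)
      then have "xss ! i \<in> lists A"
        using * nth_mem[OF i(1)] unfolding in_lists_conv_set by blast
      then show "z \<in> und_pairs P A"
        using * i by (auto simp: list_all2_conv_all_nth)
    qed
    then have "\<theta> (comp_pair P p (zip qs xss)) = \<theta> (p, map \<theta> (zip qs xss))"
      using r * len by simp
    then show "\<theta> (mu P (map length xss) p qs, concat xss) = \<theta> (p, map \<theta> (zip qs xss))"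
      using len by (simp add: comp_pair_def map_map[symmetric] del: map_map)
  qed
  then show ?thesis
    unfolding is_operad_alg_def und_pairs_def by (simp only:) blast
qed

lemma Hom_operad_alg_iff:
  "f \<in> Hom (operad_alg L P) (A, \<theta>) (B, \<theta>') \<longleftrightarrow> f \<in> A \<rightarrow>\<^sub>E B \<and>
    (\<forall>p xs. (p, xs) \<in> und_pairs P A \<longrightarrow> f (\<theta> (p, xs)) = \<theta>' (p, map f xs))"
  by (auto simp: operad_alg_def)

lemma cat_operad_alg: "cat (operad_alg L P)"
proof (unfold_locales, goal_cases)
  case (1 X)
  then obtain A \<theta> where X: "X = (A, \<theta>)" and \<theta>: "\<theta> \<in> und_pairs P A \<rightarrow>\<^sub>E A"
    by (auto simp: operad_alg_def is_operad_alg_iff)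
  have eq: "(\<lambda>x\<in>A. x) (\<theta> (p, xs)) = \<theta> (p, map (\<lambda>x\<in>A. x) xs)" if "(p, xs) \<in> und_pairs P A" for p xs
  proof -
    have "map (\<lambda>x\<in>A. x) xs = xs"
      using that by (intro map_idI) (auto simp: in_lists_conv_set)
    then show ?thesis
      using PiE_mem[OF \<theta> that] by simp
  qed
  have "(\<lambda>x\<in>A. x) \<in> Hom (operad_alg L P) (A, \<theta>) (A, \<theta>)"
    by (intro iffD2[OF Hom_operad_alg_iff] conjI allI impI Idn_Sets_PiE eq)
  then show ?case
    by (simp add: X operad_alg_def)
next
  case (2 X Y Z f g)
  then obtain A \<theta> B \<theta>' D \<theta>'' where X: "X = (A, \<theta>)" "Y = (B, \<theta>')" "Z = (D, \<theta>'')"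
    and \<theta>: "\<theta> \<in> und_pairs P A \<rightarrow>\<^sub>E A"
    by (auto simp: operad_alg_def is_operad_alg_iff)
  have f: "f \<in> A \<rightarrow>\<^sub>E B" "\<And>p xs. (p, xs) \<in> und_pairs P A \<Longrightarrow> f (\<theta> (p, xs)) = \<theta>' (p, map f xs)"
    and g: "g \<in> B \<rightarrow>\<^sub>E D" "\<And>p xs. (p, xs) \<in> und_pairs P B \<Longrightarrow> g (\<theta>' (p, xs)) = \<theta>'' (p, map g xs)"
    using 2(4,5) unfolding X Hom_operad_alg_iff by blast+
  have eq: "compose A g f (\<theta> (p, xs)) = \<theta>'' (p, map (compose A g f) xs)"
    if p: "(p, xs) \<in> und_pairs P A" for p xs
  proof -
    have xs: "xs \<in> lists A" "p \<in> Op P (length xs)"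
      using p by simp_all
    have "map f xs \<in> lists B"
      using f(1) by (intro map_in_lists[OF xs(1)]) auto
    then have "compose A g f (\<theta> (p, xs)) = \<theta>'' (p, map g (map f xs))"
      using g(2)[of p "map f xs"] f(2)[OF p] PiE_mem[OF \<theta> p] xs(2) by (simp add: compose_eq)
    also have "map g (map f xs) = map (compose A g f) xs"
      using xs(1) by (auto simp: compose_eq in_lists_conv_set)
    finally show ?thesis .
  qed
  have "compose A g f \<in> Hom (operad_alg L P) (A, \<theta>) (D, \<theta>'')"
    by (intro iffD2[OF Hom_operad_alg_iff] conjI allI impI compose_PiE[OF f(1) g(1)] eq)
  then show ?case
    by (simp add: X operad_alg_def)
next
  case (3 X Y f)
  then show ?case
    by (auto simp: operad_alg_def compose_Idn_right)
next
  case (4 X Y f)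
  then show ?case
    by (auto simp: operad_alg_def compose_Idn_left)
next
  case (5 W X Y Z f g h)
  then show ?case
    by (auto simp: operad_alg_def compose_compose)
qed

text \<open>Equivariance makes \<open>\<theta>\<close> constant on classes. Through this, the
  equalities of classes proved for the monads become equalities of values for algebras.\<close>

lemma (in lambda_module) alg_cong:
  assumes \<theta>: "is_operad_alg L P A \<theta>" and z: "z \<in> und_pairs P A" "z' \<in> und_pairs P A"
    and eq: "und_cls L P z = und_cls L P z'"
  shows "\<theta> z = \<theta> z'"
proof -
  obtain q xs p ys where zz: "z = (q, xs)" "z' = (p, ys)"
    by fastforce
  obtain g where "p \<in> Op P (length xs)" "g \<in> Op L (length xs)" "q = act P (length xs) p g"
    "ys = lact (proj L (length xs) g) xs"
    using eq und_cls_eq_iff[OF z] by (auto simp: zz und_rel_iff)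
  moreover have "xs \<in> lists A"
    using z by (simp add: zz)
  ultimately show ?thesis
    using \<theta> unfolding is_operad_alg_iff zz by blast
qed

section \<open>Passage between algebras over \<open>P\<close> and over the induced operad\<close>

context lambda_operad
begin

definition alg_to_ind :: "'u set \<times> ('p \<times> 'u list \<Rightarrow> 'u) \<Rightarrow>
    'u set \<times> (('p \<times> (nat \<Rightarrow> nat)) set \<times> 'u list \<Rightarrow> 'u)" where
  "alg_to_ind = (\<lambda>(A, \<theta>). (A, \<lambda>v\<in>und_pairs I A. \<theta> (unind_pair v)))"

definition alg_from_ind :: "'u set \<times> (('p \<times> (nat \<Rightarrow> nat)) set \<times> 'u list \<Rightarrow> 'u) \<Rightarrow>
    'u set \<times> ('p \<times> 'u list \<Rightarrow> 'u)" where
  "alg_from_ind = (\<lambda>(A, \<theta>). (A, \<lambda>z\<in>und_pairs P A. \<theta> (ind z)))"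

text \<open>The arbitrary representative in \<open>unind_pair v\<close> may be exchanged for any
  pair with the same image class, since injectivity brings that equality back to classes over
  \<open>P\<close>.\<close>

lemma alg_unind_cong:
  assumes \<theta>: "is_operad_alg L P A \<theta>" and v: "v \<in> und_pairs I A" and z: "z \<in> und_pairs P A"
    and eq: "und_cls Symm I v = und_cls Symm I (ind z)"
  shows "\<theta> (unind_pair v) = \<theta> z"
  using module.alg_cong[OF \<theta> unind_pair(1)[OF v] z] unind_pair[OF v] eq
    und_cls_ind_eq_iff[OF unind_pair(1)[OF v] z] by simp

lemma alg_to_ind:
  assumes \<theta>: "is_operad_alg L P A \<theta>"
  shows "is_operad_alg Symm I A (\<lambda>v\<in>und_pairs I A. \<theta> (unind_pair v))"
proof -
  let ?\<theta> = "\<lambda>v\<in>und_pairs I A. \<theta> (unind_pair v)"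
  have \<theta>_PiE: "\<theta> \<in> und_pairs P A \<rightarrow>\<^sub>E A"
    and unit: "\<And>x. x \<in> A \<Longrightarrow> \<theta> (ident P, [x]) = x"
    and mult: "\<And>p zs. \<lbrakk>p \<in> Op P (length zs); zs \<in> lists (und_pairs P A)\<rbrakk> \<Longrightarrow>
      \<theta> (comp_pair P p zs) = \<theta> (p, map \<theta> zs)"
    using \<theta> unfolding is_operad_alg_iff by blast+
  have \<theta>': "\<theta> (unind_pair v) \<in> A" if "v \<in> und_pairs I A" for v
    using PiE_mem[OF \<theta>_PiE] unind_pair(1)[OF that] .
  have "?\<theta> (ident I, [x]) = x" if "x \<in> A" for x
  proof -
    have z: "(ident P, [x]) \<in> und_pairs P A"
      using that ident_Op by simp
    then show ?thesis
      using alg_unind_cong[OF \<theta> ind_in_pairs[OF z] z] ind_in_pairs[OF z] unit[OF that]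
      by (simp add: ident_induced del: und_pairs_iff)
  qed
  moreover have "?\<theta> (comp_pair I C vs) = ?\<theta> (C, map ?\<theta> vs)"
    if C: "C \<in> Op I (length vs)" "vs \<in> lists (und_pairs I A)" for C vs
  proof -
    obtain p \<tau> where rep: "rep C = (p, \<tau>)"
      by fastforce
    note p = rep_induced(1,2)[OF C(1) rep]
    have ws: "lact \<tau> (map unind_pair vs) \<in> lists (und_pairs P A)"
      using map_in_lists[OF C(2) unind_pair(1)] p(2)
      by (simp add: lact_in_lists_iff)
    note pair = comp_pair_induced[OF C rep]
    have "?\<theta> (comp_pair I C vs) = \<theta> (unind_pair (comp_pair I C vs))"
      using pair(1) by simp
    also have "\<dots> = \<theta> (comp_pair P p (lact \<tau> (map unind_pair vs)))"
      using p(1) ws by (intro alg_unind_cong[OF \<theta> pair(1) _ pair(2)] comp_pair_in) simp_all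
    also have "\<dots> = \<theta> (p, map \<theta> (lact \<tau> (map unind_pair vs)))"
      using p(1) ws by (intro mult) simp_all
    also have "map \<theta> (lact \<tau> (map unind_pair vs)) = lact \<tau> (map \<theta> (map unind_pair vs))"
      using p(2) by (intro lact_map[symmetric]) simp
    also have "map \<theta> (map unind_pair vs) = map ?\<theta> vs"
      using C(2) unfolding in_lists_conv_set by simp
    \<comment> \<open>The operation \<open>C\<close> has not changed, so its representative
      \<open>(p, \<tau>)\<close> has not either, and the permuted list of values is again what
      \<open>unind_pair\<close> produces.\<close>
    also have "(p, lact \<tau> (map ?\<theta> vs)) = unind_pair (C, map ?\<theta> vs)"
      by (simp add: unind_pair_def rep)
    also have "\<theta> \<dots> = ?\<theta> (C, map ?\<theta> vs)"
    proof -
      have "map ?\<theta> vs \<in> lists A"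
        by (rule map_in_lists[OF C(2)]) (simp add: \<theta>' del: und_pairs_iff)
      then show ?thesis
        using C(1) by (simp only: restrict_apply und_pairs_iff length_map simp_thms if_True)
    qed
    finally show ?thesis .
  qed
  moreover have "?\<theta> (act I (length xs) C \<sigma>, xs) = ?\<theta> (C, lact (proj Symm (length xs) \<sigma>) xs)"
    if "xs \<in> lists A" "C \<in> Op I (length xs)" "\<sigma> \<in> Op Symm (length xs)" for C \<sigma> xs
  proof -
    have v: "(act I (length xs) C \<sigma>, xs) \<in> und_pairs I A" "(C, lact \<sigma> xs) \<in> und_pairs I A"
      using that ind.act_Op by (simp_all add: lact_in_lists_iff)
    have "und_cls Symm I (act I (length xs) C \<sigma>, xs) = und_cls Symm I (C, lact \<sigma> xs)"
      using ind.und_cls_act[OF that(2,3)] by simp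
    then show ?thesis
      using v alg_unind_cong[OF \<theta> v(1) unind_pair(1)[OF v(2)]] unind_pair(2)[OF v(2)]
      by (simp del: und_pairs_iff)
  qed
  ultimately show ?thesis
    unfolding is_operad_alg_iff using \<theta>' by (auto simp del: und_pairs_iff)
qed

lemma alg_from_ind:
  assumes \<theta>: "is_operad_alg Symm I A \<theta>"
  shows "is_operad_alg L P A (\<lambda>z\<in>und_pairs P A. \<theta> (ind z))"
proof -
  let ?\<theta> = "\<lambda>z\<in>und_pairs P A. \<theta> (ind z)"
  have \<theta>_PiE: "\<theta> \<in> und_pairs I A \<rightarrow>\<^sub>E A"
    and unit: "\<And>x. x \<in> A \<Longrightarrow> \<theta> (ident I, [x]) = x"
    and mult: "\<And>C vs. \<lbrakk>C \<in> Op I (length vs); vs \<in> lists (und_pairs I A)\<rbrakk> \<Longrightarrow>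
      \<theta> (comp_pair I C vs) = \<theta> (C, map \<theta> vs)"
    using \<theta> unfolding is_operad_alg_iff by blast+
  have \<theta>': "\<theta> (ind z) \<in> A" if "z \<in> und_pairs P A" for z
    using PiE_mem[OF \<theta>_PiE] ind_in_pairs[OF that] .
  have "?\<theta> (ident P, [x]) = x" if "x \<in> A" for x
    using that ident_Op unit[OF that] by (simp add: ident_induced)
  moreover have "?\<theta> (comp_pair P p zs) = ?\<theta> (p, map ?\<theta> zs)"
    if p: "p \<in> Op P (length zs)" "zs \<in> lists (und_pairs P A)" for p zs
  proof -
    let ?C = "ind_cls L P (length zs) (p, id)"
    have C: "?C \<in> Op I (length (map ind zs))"
      using p(1) by (simp add: ind_cls_Op permutes_id)
    have ind_zs: "map ind zs \<in> lists (und_pairs I A)"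
      using p(2) ind_in_pairs by (rule map_in_lists)
    have pair: "comp_pair P p zs \<in> und_pairs P A"
      using p by (rule comp_pair_in)
    have ind_mult: "comp_pair I ?C (map ind zs) \<in> und_pairs I A"
      using comp_pair_induced(1)[OF C ind_zs prod.collapse[symmetric]] .
    \<comment> \<open>Here the equality of outer classes required by
      \<open>comp_pair_induced_eq\<close> is a literal equality of pairs.\<close>
    have "und_cls Symm I (ind (comp_pair P p zs)) = und_cls Symm I (comp_pair I ?C (map ind zs))"
      by (rule comp_pair_induced_eq[OF C ind_zs p, symmetric]) (simp add: ind_pair_def)
    then have "?\<theta> (comp_pair P p zs) = \<theta> (comp_pair I ?C (map ind zs))"
      using ind.alg_cong[OF \<theta> ind_in_pairs[OF pair] ind_mult] pair by simp
    also have "\<dots> = \<theta> (?C, map \<theta> (map ind zs))"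
      using C ind_zs by (rule mult)
    also have "map \<theta> (map ind zs) = map ?\<theta> zs"
      using p(2) unfolding in_lists_conv_set by simp
    also have "(?C, map ?\<theta> zs) = ind (p, map ?\<theta> zs)"
      by (simp add: ind_pair_def)
    also have "\<theta> \<dots> = ?\<theta> (p, map ?\<theta> zs)"
    proof -
      have "map ?\<theta> zs \<in> lists A"
        by (rule map_in_lists[OF p(2)]) (simp add: \<theta>' del: und_pairs_iff)
      then show ?thesis
        using p(1) by (simp only: restrict_apply und_pairs_iff length_map simp_thms if_True)
    qed
    finally show ?thesis .
  qed
  moreover have "?\<theta> (act P (length xs) p g, xs) = ?\<theta> (p, lact (proj L (length xs) g) xs)"
    if "xs \<in> lists A" "p \<in> Op P (length xs)" "g \<in> Op L (length xs)" for p g xs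
  proof -
    have z: "(act P (length xs) p g, xs) \<in> und_pairs P A"
      "(p, lact (proj L (length xs) g) xs) \<in> und_pairs P A"
      using that act_Op module.proj_permutes by (simp_all add: lact_in_lists_iff)
    have "und_cls Symm I (ind (act P (length xs) p g, xs)) =
        und_cls Symm I (ind (p, lact (proj L (length xs) g) xs))"
      using module.und_cls_act[OF that(2,3)] und_cls_ind_eq_iff[OF z] by simp
    then show ?thesis
      using z ind.alg_cong[OF \<theta> ind_in_pairs[OF z(1)] ind_in_pairs[OF z(2)]]
      by (simp del: und_pairs_iff)
  qed
  ultimately show ?thesis
    unfolding is_operad_alg_iff using \<theta>' by (auto simp del: und_pairs_iff)
qed

text \<open>Proved directly on structure maps, which are functions on pairs and need no coding. Both
  constructions keep the underlying set; only the inverse laws and the homomorphism conditions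
  remain to be compared.\<close>

lemma isomorphic_operad_algs:
  "isomorphic_cats (operad_alg L P :: ('u set \<times> ('p \<times> 'u list \<Rightarrow> 'u), 'u \<Rightarrow> 'u) cat)
    (operad_alg Symm I :: ('u set \<times> (('p \<times> (nat \<Rightarrow> nat)) set \<times> 'u list \<Rightarrow> 'u), 'u \<Rightarrow> 'u) cat)"
proof (rule isomorphic_catsI[where F = alg_to_ind and G = alg_from_ind])
  fix X :: "'u set \<times> ('p \<times> 'u list \<Rightarrow> 'u)"
  assume "X \<in> Ob (operad_alg L P)"
  then obtain A \<theta> where X: "X = (A, \<theta>)" and \<theta>: "is_operad_alg L P A \<theta>"
    by (auto simp: operad_alg_def)
  show "alg_to_ind X \<in> Ob (operad_alg Symm I)"
    using alg_to_ind[OF \<theta>] by (simp add: X alg_to_ind_def operad_alg_def)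
  have "(\<lambda>z\<in>und_pairs P A. (\<lambda>v\<in>und_pairs I A. \<theta> (unind_pair v)) (ind z)) = \<theta>"
  proof (rule extensionalityI[of _ "und_pairs P A"])
    show "\<theta> \<in> extensional (und_pairs P A)"
      using \<theta> by (auto simp: is_operad_alg_iff PiE_iff)
    fix z assume z: "z \<in> und_pairs P A"
    show "(\<lambda>z\<in>und_pairs P A. (\<lambda>v\<in>und_pairs I A. \<theta> (unind_pair v)) (ind z)) z = \<theta> z"
      using alg_unind_cong[OF \<theta> ind_in_pairs[OF z] z] ind_in_pairs[OF z] z by simp
  qed simp
  then show "alg_from_ind (alg_to_ind X) = X"
    by (simp add: X alg_to_ind_def alg_from_ind_def)
  show "Idn (operad_alg Symm I) (alg_to_ind X) = Idn (operad_alg L P) X"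
    by (simp add: X alg_to_ind_def operad_alg_def)
next
  fix Y :: "'u set \<times> (('p \<times> (nat \<Rightarrow> nat)) set \<times> 'u list \<Rightarrow> 'u)"
  assume "Y \<in> Ob (operad_alg Symm I)"
  then obtain A \<theta> where Y: "Y = (A, \<theta>)" and \<theta>: "is_operad_alg Symm I A \<theta>"
    by (auto simp: operad_alg_def)
  show "alg_from_ind Y \<in> Ob (operad_alg L P)"
    using alg_from_ind[OF \<theta>] by (simp add: Y alg_from_ind_def operad_alg_def)
  have "(\<lambda>v\<in>und_pairs I A. (\<lambda>z\<in>und_pairs P A. \<theta> (ind z)) (unind_pair v)) = \<theta>"
  proof (rule extensionalityI[of _ "und_pairs I A"])
    show "\<theta> \<in> extensional (und_pairs I A)"
      using \<theta> by (auto simp: is_operad_alg_iff PiE_iff)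
    fix v assume v: "v \<in> und_pairs I A"
    show "(\<lambda>v\<in>und_pairs I A. (\<lambda>z\<in>und_pairs P A. \<theta> (ind z)) (unind_pair v)) v = \<theta> v"
      using ind.alg_cong[OF \<theta> ind_in_pairs[OF unind_pair(1)[OF v]] v] unind_pair[OF v] v by simp
  qed simp
  then show "alg_to_ind (alg_from_ind Y) = Y"
    by (simp add: Y alg_to_ind_def alg_from_ind_def)
next
  fix X Y :: "'u set \<times> ('p \<times> 'u list \<Rightarrow> 'u)"
  assume XY: "X \<in> Ob (operad_alg L P)" "Y \<in> Ob (operad_alg L P)"
  then obtain A \<theta> B \<theta>' where X: "X = (A, \<theta>)" and \<theta>: "is_operad_alg L P A \<theta>"
    and Y: "Y = (B, \<theta>')" and \<theta>': "is_operad_alg L P B \<theta>'"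
    by (auto simp: operad_alg_def)
  let ?\<theta> = "\<lambda>v\<in>und_pairs I A. \<theta> (unind_pair v)" and ?\<theta>' = "\<lambda>v\<in>und_pairs I B. \<theta>' (unind_pair v)"
  have "(\<forall>C xs. (C, xs) \<in> und_pairs I A \<longrightarrow> f (?\<theta> (C, xs)) = ?\<theta>' (C, map f xs)) \<longleftrightarrow>
      (\<forall>p xs. (p, xs) \<in> und_pairs P A \<longrightarrow> f (\<theta> (p, xs)) = \<theta>' (p, map f xs))" (is "?l \<longleftrightarrow> ?r")
    if f: "f \<in> A \<rightarrow>\<^sub>E B" for f
  proof -
    have map_f: "map f xs \<in> lists B" if "xs \<in> lists A" for xs
      using f by (intro map_in_lists[OF that]) auto
    show ?thesis
    proof (intro iffI allI impI)
      fix p xs assume ?l and z: "(p, xs) \<in> und_pairs P A"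
      have z': "(p, map f xs) \<in> und_pairs P B"
        using z map_f by simp
      have "f (?\<theta> (ind (p, xs))) = ?\<theta>' (ind (p, map f xs))"
        using \<open>?l\<close> ind_in_pairs[OF z] by (simp add: ind_pair_def del: und_pairs_iff)
      then show "f (\<theta> (p, xs)) = \<theta>' (p, map f xs)"
        using alg_unind_cong[OF \<theta> ind_in_pairs[OF z] z] alg_unind_cong[OF \<theta>' ind_in_pairs[OF z'] z']
          ind_in_pairs[OF z] ind_in_pairs[OF z'] by simp
    next
      fix C xs assume ?r and v: "(C, xs) \<in> und_pairs I A"
      have v': "(C, map f xs) \<in> und_pairs I B"
        using v map_f by simp
      obtain p \<tau> where rep: "rep C = (p, \<tau>)"
        by fastforce
      have "\<tau> permutes {..<length xs}"
        using v rep_induced(2)[OF _ rep] by simp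
      \<comment> \<open>Source and target involve the same \<open>C\<close>, hence the same
        representative, and relabelling by \<open>f\<close> commutes with permuting by
        \<open>\<tau>\<close>.\<close>
      then have "unind_pair (C, map f xs) = (p, map f (lact \<tau> xs))"
        by (simp add: unind_pair_def rep lact_map)
      moreover have "unind_pair (C, xs) = (p, lact \<tau> xs)"
        by (simp add: unind_pair_def rep)
      ultimately show "f (?\<theta> (C, xs)) = ?\<theta>' (C, map f xs)"
        using \<open>?r\<close> unind_pair(1)[OF v] v v' by (simp del: und_pairs_iff)
    qed
  qed
  then show "Hom (operad_alg Symm I) (alg_to_ind X) (alg_to_ind Y) = Hom (operad_alg L P) X Y"
    unfolding X Y alg_to_ind_def prod.case set_eq_iff Hom_operad_alg_iff by blast
next
  fix X Y Z :: "'u set \<times> ('p \<times> 'u list \<Rightarrow> 'u)"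
  show "Cmp (operad_alg Symm I) (alg_to_ind X) (alg_to_ind Y) (alg_to_ind Z) =
      Cmp (operad_alg L P) X Y Z"
    by (cases X; cases Y; cases Z) (simp add: alg_to_ind_def operad_alg_def)
qed (rule cat_operad_alg)+

end

theorem corollary8p25:
  fixes L :: "'l action_operad_data"
    and P :: "('p, 'l) lambda_operad_data"
    and c :: "('p \<times> 'u list) set \<Rightarrow> 'u"
    and d :: "(('p \<times> (nat \<Rightarrow> nat)) set \<times> 'u list) set \<Rightarrow> 'u"
  assumes "action_operad L" and "lambda_operad L P"
    and "inj_on c (und_obj L P UNIV)"
    and "inj_on d (und_obj Symm (induced L P) UNIV)"
  shows "(\<exists>\<phi>. mnd_iso Sets (und_mnd c L P) (und_mnd d Symm (induced L P)) \<phi>) \<and>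
    isomorphic_cats (mnd_alg Sets (und_mnd c L P))
      (mnd_alg Sets (und_mnd d Symm (induced L P))) \<and>
    isomorphic_cats (operad_alg L P :: ('u set \<times> ('p \<times> 'u list \<Rightarrow> 'u), 'u \<Rightarrow> 'u) cat)
      (operad_alg Symm (induced L P)
        :: ('u set \<times> (('p \<times> (nat \<Rightarrow> nat)) set \<times> 'u list \<Rightarrow> 'u), 'u \<Rightarrow> 'u) cat)"
proof -
  interpret lambda_operad L P
    by fact
  have "presented_monads P (c \<circ> und_cls L P) (d \<circ> und_cls Symm (induced L P) \<circ> ind_pair L P)
      (und_mnd c L P) (und_mnd d Symm (induced L P))"
    using assms(3,4) by (rule presented_monads_und_mnd)
  from presented_monads.mnd_iso[OF this] presented_monads.isomorphic_mnd_algs[OF this]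
  show ?thesis
    using isomorphic_operad_algs by blast
qed

end
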